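(* Let $(M,d)$ be a (nonempty) compact and perfect metric space, let $X=M^{\mathbb{Z}}$ be endowed with the metric $$r(x,y)=\sum_{n\in\mathbb{Z}}\min\left\{\frac{1}{a_{|n|}+1},\,d(x_n,y_n)\right\},$$ where $(a_n)_{n\ge 0}$ is any monotone increasing sequence of nonnegative real numbers such that $\sum_{k\ge 0}\frac{1}{a_k+1}<\infty$ and, for each $\alpha>0$, $\lim_{k\to\infty}\frac{a_k}{e^{\alpha k}}=0$. Let $T:X\to X$ be the full-shift, $(Tx)_i=x_{i-1}$ for $i\in\mathbb{Z}$, and let $q>1$. Then $$CD=\{\mu\in\mathcal{M}(T)\mid D^+_\mu(q)=+\infty\}$$ is a dense $G_\delta$ subset of $\mathcal{M}(T)$.
   Context: A metric space is perfect if it has no isolated points. $\mathcal{M}(T)$ is the space of $T$-invariant Borel probability measures on $X$, endowed with the weak topology ($\mu_\alpha\to\mu$ iff $\int f\,d\mu_\alpha\to\int f\,d\mu$ for every bounded continuous $f:X\to\mathbb{R}$). For a Borel probability measure $\mu$ on $X$, $q\in(0,\infty)\setminus\{1\}$ and $\varepsilon\in(0,1)$, let $I_\mu(q,\varepsilon)=\int_{\operatorname{supp}(\mu)}\mu(B(x,\varepsilon))^{q-1}\,d\mu(x)$, where $B(x,\varepsilon)$ is the open $r$-ball and $\operatorname{supp}(\mu)$ the topological support. The upper $q$-generalized fractal dimension is $D^+_\mu(q)=\limsup_{\varepsilon\downarrow 0}\frac{\log I_\mu(q,\varepsilon)}{(q-1)\log\varepsilon}$. *)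

theory Defs
  imports "HOL-Probability.Probability"
begin

text \<open>
  Metrics are passed explicitly as functions \<open>r\<close> on a whole type, because the metric put on
  \<open>int \<Rightarrow> 'a\<close> below is not the one of a type class instance.
\<close>

abbreviation metric_topology :: "('x \<Rightarrow> 'x \<Rightarrow> real) \<Rightarrow> 'x topology" where
  "metric_topology r \<equiv> Metric_space.mtopology UNIV r"

abbreviation metric_ball :: "('x \<Rightarrow> 'x \<Rightarrow> real) \<Rightarrow> 'x \<Rightarrow> real \<Rightarrow> 'x set" where
  "metric_ball r \<equiv> Metric_space.mball UNIV r"

definition borel_of :: "'x topology \<Rightarrow> 'x measure" where
  "borel_of X = sigma (topspace X) {U. openin X U}"

definition borel_probs :: "'x topology \<Rightarrow> 'x measure set" where
  "borel_probs X = {\<mu>. prob_space \<mu> \<and> sets \<mu> = sets (borel_of X)}"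

definition invariant_probs :: "'x topology \<Rightarrow> ('x \<Rightarrow> 'x) \<Rightarrow> 'x measure set" where
  "invariant_probs X T =
     {\<mu> \<in> borel_probs X. \<forall>A \<in> sets \<mu>. emeasure \<mu> (T -` A \<inter> space \<mu>) = emeasure \<mu> A}"

text \<open>
  The coarsest topology on a set \<open>S\<close> of measures making \<open>\<mu> \<mapsto> \<integral> f d\<mu>\<close> continuous for every
  bounded continuous \<open>f\<close>; its convergent nets are exactly the weakly convergent ones.
\<close>

definition weak_topology :: "'x topology \<Rightarrow> 'x measure set \<Rightarrow> 'x measure topology" where
  "weak_topology X S = topology_generated_by
     {{\<mu> \<in> S. (\<integral>x. f x \<partial>\<mu>) \<in> U} | f U.
        continuous_map X euclideanreal f \<and> bounded (f ` topspace X) \<and> open U}"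

definition measure_support :: "'x topology \<Rightarrow> 'x measure \<Rightarrow> 'x set" where
  "measure_support X \<mu> =
     {x \<in> topspace X. \<forall>U. openin X U \<and> x \<in> U \<longrightarrow> emeasure \<mu> U > 0}"

definition correlation_integral ::
    "('x \<Rightarrow> 'x \<Rightarrow> real) \<Rightarrow> 'x measure \<Rightarrow> real \<Rightarrow> real \<Rightarrow> real" where
  "correlation_integral r \<mu> q \<epsilon> =
     (LINT x : measure_support (metric_topology r) \<mu> | \<mu>.
        measure \<mu> (metric_ball r x \<epsilon>) powr (q - 1))"

definition upper_gen_dim :: "('x \<Rightarrow> 'x \<Rightarrow> real) \<Rightarrow> 'x measure \<Rightarrow> real \<Rightarrow> ereal" where
  "upper_gen_dim r \<mu> q =
     Limsup (at_right 0)
       (\<lambda>\<epsilon>. ereal (ln (correlation_integral r \<mu> q \<epsilon>) / ((q - 1) * ln \<epsilon>)))"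

definition seq_metric ::
    "(nat \<Rightarrow> real) \<Rightarrow> (int \<Rightarrow> 'a::metric_space) \<Rightarrow> (int \<Rightarrow> 'a) \<Rightarrow> real" where
  "seq_metric a x y = (\<Sum>\<^sub>\<infinity>n. min (1 / (a (nat \<bar>n\<bar>) + 1)) (dist (x n) (y n)))"

definition full_shift :: "(int \<Rightarrow> 'a) \<Rightarrow> (int \<Rightarrow> 'a)" where
  "full_shift x = (\<lambda>i. x (i - 1))"

lemma summable_on_int_abs:
  fixes f :: "nat \<Rightarrow> real"
  assumes "summable f" "\<And>k. 0 \<le> f k"
  shows "(\<lambda>n::int. f (nat \<bar>n\<bar>)) summable_on UNIV"
proof -
  have f: "f summable_on UNIV"
    using assms by (simp add: summable_on_UNIV_nonneg_real_iff)
  have A: "(\<lambda>n::int. f (nat \<bar>n\<bar>)) summable_on range int"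
    by (subst summable_on_reindex) (auto simp: o_def f)
  have B: "(\<lambda>n::int. f (nat \<bar>n\<bar>)) summable_on range (\<lambda>k. - int k)"
    by (subst summable_on_reindex) (auto simp: o_def f inj_on_def)
  have "range int \<union> range (\<lambda>k. - int k) = UNIV"
    by (auto simp: image_iff) (metis int_cases2)
  then show ?thesis
    using summable_on_union[OF A B] by simp
qed

lemma seq_metric_summable:
  fixes x y :: "int \<Rightarrow> 'a::metric_space"
  assumes "\<And>k. 0 \<le> a k" "summable (\<lambda>k. 1 / (a k + 1))"
  shows "(\<lambda>n::int. min (1 / (a (nat \<bar>n\<bar>) + 1)) (dist (x n) (y n))) summable_on UNIV"
proof (rule summable_on_comparison_test)
  show "(\<lambda>n::int. 1 / (a (nat \<bar>n\<bar>) + 1)) summable_on UNIV"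
    using summable_on_int_abs[OF assms(2)] assms(1) by (simp add: add_nonneg_nonneg)
qed (auto simp: assms(1) add_nonneg_nonneg)

lemma Metric_space_seq_metric:
  assumes a: "\<And>k. 0 \<le> a k" "summable (\<lambda>k. 1 / (a k + 1))"
  shows "Metric_space UNIV (seq_metric a :: (int \<Rightarrow> 'a::metric_space) \<Rightarrow> _)"
proof
  fix x y z :: "int \<Rightarrow> 'a"
  let ?t = "\<lambda>x y (n::int). min (1 / (a (nat \<bar>n\<bar>) + 1)) (dist (x n :: 'a) (y n))"
  have pos: "1 / (a k + 1) > 0" for k
    using a(1)[of k] by simp
  have nn: "?t x y n \<ge> 0" for x y n
    using pos[of "nat \<bar>n\<bar>"] by (simp add: min_def)
  note s = seq_metric_summable[of a, OF a]
  show "0 \<le> seq_metric a x y"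
    unfolding seq_metric_def by (rule infsum_nonneg) (rule nn)
  show "seq_metric a x y = seq_metric a y x"
    by (simp add: seq_metric_def dist_commute)
  show "seq_metric a x y = 0 \<longleftrightarrow> x = y"
  proof
    assume "seq_metric a x y = 0"
    then have z: "?t x y n = 0" for n
      using nonneg_infsum_le_0D[OF _ s[of x y], of n] nn unfolding seq_metric_def by simp
    have "x n = y n" for n
      using z[of n] pos[of "nat \<bar>n\<bar>"] by (auto simp: min_def split: if_splits)
    then show "x = y" by auto
  next
    assume "x = y"
    then show "seq_metric a x y = 0"
      by (simp add: seq_metric_def min_absorb2 add_nonneg_nonneg a(1))
  qed
  have "seq_metric a x z \<le> (\<Sum>\<^sub>\<infinity>n. ?t x y n + ?t y z n)"
    unfolding seq_metric_def
  proof (rule infsum_mono)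
    show "(\<lambda>n. ?t x y n + ?t y z n) summable_on UNIV"
      by (intro summable_on_add s)
    have min_triangle: "min c u \<le> min c v + min c w"
      if "0 < c" "u \<le> v + w" "0 \<le> v" "0 \<le> w" for c u v w :: real
      using that by (auto simp: min_def)
    show "?t x z n \<le> ?t x y n + ?t y z n" for n
      by (rule min_triangle[OF pos dist_triangle zero_le_dist zero_le_dist])
  qed (rule s)
  also have "\<dots> = seq_metric a x y + seq_metric a y z"
    unfolding seq_metric_def by (intro infsum_add s)
  finally show "seq_metric a x z \<le> seq_metric a x y + seq_metric a y z" .
qed

lemma topspace_weak_topology: "topspace (weak_topology X S) = S"
proof -
  have "S \<in> {{\<mu> \<in> S. (\<integral>x. f x \<partial>\<mu>) \<in> U} | f U.
        continuous_map X euclideanreal f \<and> bounded (f ` topspace X) \<and> open U}"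
    by (rule CollectI, rule exI[of _ "\<lambda>_. 0"], rule exI[of _ UNIV])
       (auto simp: image_constant_conv)
  then show ?thesis
    unfolding weak_topology_def topology_generated_by_topspace by blast
qed

end

theory Submission
  imports Defs "HOL-Real_Asymp.Real_Asymp"
begin

text \<open>
  Replacing indicators of balls by continuous bumps gives functionals \<open>J(\<mu>, \<epsilon>)\<close> that are weakly
  continuous in \<open>\<mu>\<close> and satisfy \<open>I(\<mu>, \<epsilon> / 2) \<le> J(\<mu>, \<epsilon>) \<le> I(\<mu>, \<epsilon>)\<close>. Hence the upper dimension is
  infinite iff for every \<open>n\<close> there is some \<open>\<epsilon> < 1 / (n + 1)\<close> with \<open>J(\<mu>, \<epsilon>) < \<epsilon> ^ n\<close>, and this is a
  countable intersection of open conditions.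

  For density, let \<open>\<mu>\<close> be invariant. Since the alphabet is perfect and compact, there are Borel maps
  \<open>p, p'\<close> close to the identity with \<open>p(z)\<close> and \<open>p'(z)\<close> at least \<open>2 \<rho>\<close> apart. Replace each
  coordinate \<open>x\<^sub>n\<close> of a \<open>\<mu>\<close>-random point by \<open>p(x\<^sub>n)\<close> or \<open>p'(x\<^sub>n)\<close> according to independent fair coin
  flips. The law of the result is invariant and weakly close to \<open>\<mu>\<close>. A ball of radius \<open>\<epsilon> \<le> \<rho>\<close>
  determines the coin flips at all \<open>n\<close> with \<open>\<epsilon> \<le> 1 / (a\<^sub>|\<^sub>n\<^sub>| + 1)\<close>. By the subexponential growth of \<open>a\<close>
  there are eventually more than \<open>C log (1 / \<epsilon>)\<close> of these, for every \<open>C\<close>, so the mass of balls decays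
  faster than every power of \<open>\<epsilon>\<close>.
\<close>

section \<open>Borel sets and Borel probability measures of an abstract topology\<close>

lemma space_borel_of: "space (borel_of X) = topspace X"
  unfolding borel_of_def by (intro space_measure_of) (auto dest: openin_subset)

lemma sets_borel_of: "sets (borel_of X) = sigma_sets (topspace X) {U. openin X U}"
  unfolding borel_of_def by (intro sets_measure_of) (auto dest: openin_subset)

lemma openin_borel_of: "openin X U \<Longrightarrow> U \<in> sets (borel_of X)"
  by (simp add: sets_borel_of)

lemma borel_probsD:
  assumes "\<mu> \<in> borel_probs X"
  shows "prob_space \<mu>" "sets \<mu> = sets (borel_of X)" "space \<mu> = topspace X"
  using assms sets_eq_imp_space_eq[of \<mu> "borel_of X"]
  by (auto simp: borel_probs_def space_borel_of)

lemma measurable_borel_of: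
  assumes "f \<in> space M \<rightarrow> topspace X"
    and "\<And>U. openin X U \<Longrightarrow> f -` U \<inter> space M \<in> sets M"
  shows "f \<in> measurable M (borel_of X)"
  unfolding borel_of_def using assms
  by (intro measurable_measure_of) (auto dest: openin_subset)

lemma continuous_map_borel_measurable:
  assumes "sets M = sets (borel_of X)" "continuous_map X euclideanreal f"
  shows "f \<in> borel_measurable M"
proof (rule borel_measurableI)
  fix S :: "real set" assume "open S"
  then have "openin X {x \<in> topspace X. f x \<in> S}"
    using assms(2) by (auto simp: continuous_map_def)
  moreover have "f -` S \<inter> space M = {x \<in> topspace X. f x \<in> S}"
    using sets_eq_imp_space_eq[OF assms(1)] by (auto simp: space_borel_of)
  ultimately show "f -` S \<inter> space M \<in> sets M"
    using assms(1) openin_borel_of by simp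
qed

lemma (in prob_space) integrable_bounded_range:
  assumes "f \<in> borel_measurable M" "bounded (range f)"
  shows "integrable M (f :: _ \<Rightarrow> real)"
proof -
  obtain B where "\<And>x. norm (f x) \<le> B" using assms(2) by (auto simp: bounded_iff)
  then show ?thesis using assms(1) by (intro integrable_const_bound[of _ B]) auto
qed

section \<open>Fractal dimensions in compact metric spaces\<close>

locale compact_metric = Metric_space UNIV r
  for r :: "'x \<Rightarrow> 'x \<Rightarrow> real" +
  assumes compact: "compact_space mtopology"
begin

section \<open>Continuity, finite nets and a countable basis of balls\<close>

lemma openinI:
  assumes "\<And>x. x \<in> U \<Longrightarrow> \<exists>e>0. \<forall>y. r x y < e \<longrightarrow> y \<in> U"
  shows "openin mtopology U"
  unfolding openin_mtopology using assms by (fastforce simp: subset_iff)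

lemma openinD:
  assumes "openin mtopology U" "x \<in> U"
  shows "\<exists>e>0. \<forall>y. r x y < e \<longrightarrow> y \<in> U"
  using assms unfolding openin_mtopology by (fastforce simp: subset_iff)

lemma continuous_mapI:
  assumes "\<And>x e. 0 < e \<Longrightarrow> \<exists>d>0. \<forall>y. r x y < d \<longrightarrow> \<bar>f x - f y\<bar> < e"
  shows "continuous_map mtopology euclideanreal f"
  unfolding continuous_map_def
proof (intro conjI allI impI)
  fix U :: "real set" assume "openin euclideanreal U"
  then have U: "open U" by simp
  show "openin mtopology {x \<in> topspace mtopology. f x \<in> U}"
  proof (rule openinI)
    fix x assume "x \<in> {x \<in> topspace mtopology. f x \<in> U}"
    then obtain e where e: "e > 0" "\<And>z. dist z (f x) < e \<Longrightarrow> z \<in> U"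
      using U by (auto simp: open_dist)
    obtain d where "d > 0" "\<forall>y. r x y < d \<longrightarrow> \<bar>f x - f y\<bar> < e"
      using assms[OF e(1)] by blast
    then show "\<exists>d>0. \<forall>y. r x y < d \<longrightarrow> y \<in> {x \<in> topspace mtopology. f x \<in> U}"
      using e(2) by (intro exI[of _ d]) (auto simp: dist_real_def abs_minus_commute)
  qed
qed auto

lemma Lipschitz_continuous_map:
  assumes "0 < L" "\<And>x y. \<bar>f x - f y\<bar> \<le> L * r x y"
  shows "continuous_map mtopology euclideanreal f"
proof (rule continuous_mapI)
  fix x and e :: real assume e: "0 < e"
  show "\<exists>d>0. \<forall>y. r x y < d \<longrightarrow> \<bar>f x - f y\<bar> < e"
  proof (intro exI[of _ "e / L"] conjI allI impI)
    fix y assume "r x y < e / L"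
    then have "L * r x y < e" using assms(1) by (simp add: field_simps)
    then show "\<bar>f x - f y\<bar> < e" using assms(2)[of x y] by linarith
  qed (use e assms in simp)
qed

lemma abs_diff_le: "\<bar>r w x - r w y\<bar> \<le> r x y"
  using triangle[of w x y] triangle[of w y x] commute[of x y] by auto

lemma finite_net:
  assumes "0 < e"
  obtains K where "finite K" "\<And>x. \<exists>c\<in>K. r c x < e"
proof -
  have "mtotally_bounded UNIV"
    using compact compactin_imp_mtotally_bounded by (simp add: compact_space_def)
  then obtain K where "finite K" "UNIV \<subseteq> (\<Union>x\<in>K. mball x e)"
    using assms by (auto simp: mtotally_bounded_def)
  then show ?thesis by (intro that[of K]) (auto simp: subset_iff)
qed

text \<open>Total boundedness gives a finite \<open>1 / (n + 1)\<close>-net for each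
  \<open>n\<close>; the balls of that radius around its points are collected over all
  \<open>n\<close>. If the radius is below \<open>e / 2\<close>, such a ball containing
  \<open>x\<close> lies within distance \<open>e\<close> of \<open>x\<close>, by the triangle
  inequality through its centre.\<close>

lemma countable_ball_basis:
  obtains B where "countable B"
    "\<And>U x. openin mtopology U \<Longrightarrow> x \<in> U \<Longrightarrow> \<exists>(c, e)\<in>B. x \<in> mball c e \<and> mball c e \<subseteq> U"
proof -
  have "\<exists>K. finite K \<and> (\<forall>x. \<exists>c\<in>K. r c x < 1 / real (Suc n))" for n
    by (rule finite_net[of "1 / real (Suc n)"]) auto
  then obtain K where K: "\<And>n. finite (K n)" "\<And>n x. \<exists>c\<in>K n. r c x < 1 / real (Suc n)"
    by metis
  define B where "B = (\<Union>n. (\<lambda>c. (c, 1 / real (Suc n))) ` K n)"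
  have "\<exists>(c, e)\<in>B. x \<in> mball c e \<and> mball c e \<subseteq> U" if U: "openin mtopology U" "x \<in> U" for U x
  proof -
    obtain e where e: "e > 0" "\<And>y. r x y < e \<Longrightarrow> y \<in> U"
      using openinD[OF U] by blast
    obtain n where n: "1 / real (Suc n) < e / 2"
      using e(1) by (meson half_gt_zero nat_approx_posE)
    obtain c where c: "c \<in> K n" "r c x < 1 / real (Suc n)" using K(2) by blast
    have "r x y < e" if "r c y < 1 / real (Suc n)" for y
      using triangle[of x c y] commute[of x c] c(2) that n by auto
    then show ?thesis
      using c e(2) by (intro bexI[of _ "(c, 1 / real (Suc n))"]) (auto simp: B_def)
  qed
  moreover have "countable B"
    unfolding B_def by (rule countable_UN) (auto intro: countable_finite K(1))
  ultimately show ?thesis by (intro that[of B]) auto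
qed

text \<open>Since there is a countable basis of balls, measurability only has to be tested on balls.\<close>

lemma measurable_by_dist:
  assumes "\<And>w. (\<lambda>\<omega>. r w (f \<omega>)) \<in> borel_measurable M"
  shows "f \<in> measurable M (borel_of mtopology)"
proof (rule measurable_borel_of)
  obtain B where B: "countable B"
    "\<And>U x. openin mtopology U \<Longrightarrow> x \<in> U \<Longrightarrow> \<exists>(c, e)\<in>B. x \<in> mball c e \<and> mball c e \<subseteq> U"
    by (rule countable_ball_basis) (rule that)
  fix U assume U: "openin mtopology U"
  let ?B = "{p \<in> B. mball (fst p) (snd p) \<subseteq> U}"
  have "f -` U \<inter> space M = (\<Union>p\<in>?B. {\<omega> \<in> space M. r (fst p) (f \<omega>) < snd p})"
    using B(2)[OF U] by fastforce
  moreover have "\<dots> \<in> sets M"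
  proof (rule sets.countable_UN'')
    show "countable ?B" using B(1) by simp
    show "{\<omega> \<in> space M. r (fst p) (f \<omega>) < snd p} \<in> sets M" for p
      using assms[of "fst p"] by measurable
  qed
  ultimately show "f -` U \<inter> space M \<in> sets M" by simp
qed auto

text \<open>A Lebesgue number for the cover by preimages of balls of radius \<open>e / 2\<close>
  serves as \<open>d\<close>: two points closer than \<open>d\<close> lie in a common
  preimage.\<close>

lemma uniformly_continuous:
  assumes f: "continuous_map mtopology euclideanreal f" and e: "0 < (e::real)"
  shows "\<exists>d>0. \<forall>x y. r x y < d \<longrightarrow> \<bar>f x - f y\<bar> < e"
proof -
  let ?C = "range (\<lambda>c. {x. f x \<in> ball c (e/2)})"
  have "openin mtopology {x. f x \<in> ball c (e/2)}" for c
  proof -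
    have "openin mtopology {x \<in> topspace mtopology. f x \<in> ball c (e/2)}"
      using f by (rule openin_continuous_map_preimage) simp
    then show ?thesis by simp
  qed
  moreover have "UNIV \<subseteq> \<Union>?C"
  proof
    fix x
    show "x \<in> \<Union>?C" using e by (intro UnionI[of "{y. f y \<in> ball (f x) (e/2)}"]) auto
  qed
  ultimately obtain d where d: "d > 0" "\<And>x. \<exists>U\<in>?C. mball x d \<subseteq> U"
    using lebesgue_number[of UNIV ?C] compact unfolding compact_space_def by auto
  have "\<bar>f x - f y\<bar> < e" if "r x y < d" for x y
  proof -
    obtain c where c: "mball x d \<subseteq> {x. f x \<in> ball c (e/2)}" using d(2)[of x] by auto
    have "x \<in> mball x d" "y \<in> mball x d" using that d(1) by auto
    then have "dist c (f x) < e/2" "dist c (f y) < e/2" using c by auto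
    then show ?thesis using abs_triangle_ineq4[of "c - f x" "c - f y"]
      by (simp only: dist_real_def)
  qed
  then show ?thesis using d(1) by blast
qed

section \<open>Ball masses, supports and correlation integrals\<close>

lemma mball_sets: "mball x e \<in> sets (borel_of mtopology)"
  using openin_borel_of openin_mball by blast

text \<open>The mass of an open ball is lower semicontinuous in the centre, because the ball is
  exhausted by smaller concentric balls. Hence the superlevel sets are open.\<close>

lemma ball_measure_measurable:
  assumes "\<mu> \<in> borel_probs mtopology"
  shows "(\<lambda>x. measure \<mu> (mball x e)) \<in> borel_measurable \<mu>"
proof (rule borel_measurableI_greater)
  interpret prob_space \<mu> using borel_probsD[OF assms] by simp
  note b = borel_probsD(2)[OF assms]
  fix c :: real
  have "openin mtopology {x. c < measure \<mu> (mball x e)}"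
  proof (rule openinI)
    fix x assume x: "x \<in> {x. c < measure \<mu> (mball x e)}"
    \<comment> \<open>The radius can be nonpositive for small \<open>n\<close>; the ball is then
      empty and the sequence is still increasing.\<close>
    let ?A = "\<lambda>n. mball x (e - 1 / real (Suc n))"
    have "(\<lambda>n. measure \<mu> (?A n)) \<longlonglongrightarrow> measure \<mu> (\<Union>n. ?A n)"
    proof (rule finite_Lim_measure_incseq)
      show "range ?A \<subseteq> sets \<mu>" using b mball_sets by auto
      show "incseq ?A"
      proof (rule incseq_SucI, rule subsetI)
        fix n y assume "y \<in> ?A n"
        moreover have "1 / real (Suc (Suc n)) \<le> 1 / real (Suc n)" by (simp add: field_simps)
        ultimately show "y \<in> ?A (Suc n)" by auto
      qed
    qed
    moreover have "(\<Union>n. ?A n) = mball x e"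
    proof (intro equalityI subsetI)
      fix y assume "y \<in> mball x e"
      then have "0 < e - r x y" by auto
      then obtain n where "1 / real (Suc n) < e - r x y" using nat_approx_posE by blast
      then have "y \<in> ?A n" by auto
      then show "y \<in> (\<Union>n. ?A n)" by blast
    next
      fix y assume "y \<in> (\<Union>n. ?A n)"
      then obtain n where "r x y < e - 1 / real (Suc n)" by auto
      moreover have "0 \<le> 1 / real (Suc n)" by simp
      ultimately have "r x y < e" by linarith
      then show "y \<in> mball x e" by auto
    qed
    ultimately have "eventually (\<lambda>n. c < measure \<mu> (?A n)) sequentially"
      using x by (intro order_tendstoD(1)) auto
    then obtain n where n: "c < measure \<mu> (?A n)"
      by (meson eventually_sequentially order_refl)
    \<comment> \<open>The radius was shrunk by \<open>1 / real (Suc n)\<close>, so the centre may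
      move by less than that and the ball of radius \<open>e\<close> still covers
      \<open>?A n\<close>.\<close>
    show "\<exists>d>0. \<forall>y. r x y < d \<longrightarrow> y \<in> {x. c < measure \<mu> (mball x e)}"
    proof (intro exI[of _ "1 / real (Suc n)"] conjI allI impI)
      fix y assume y: "r x y < 1 / real (Suc n)"
      have "?A n \<subseteq> mball y e"
      proof
        fix z assume "z \<in> ?A n"
        then show "z \<in> mball y e" using triangle[of y x z] commute[of x y] y by auto
      qed
      then have "measure \<mu> (?A n) \<le> measure \<mu> (mball y e)"
        using b mball_sets by (intro finite_measure_mono) auto
      then show "y \<in> {x. c < measure \<mu> (mball x e)}" using n by auto
    qed simp
  qed
  then show "{x \<in> space \<mu>. c < measure \<mu> (mball x e)} \<in> sets \<mu>"
    using openin_borel_of b borel_probsD(3)[OF assms] by auto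
qed

text \<open>A point outside the support has a null neighbourhood, hence lies in a null ball of the
  countable basis. The complement of the support is therefore a countable union of null open
  sets.\<close>

lemma measure_support_full:
  assumes "\<mu> \<in> borel_probs mtopology"
  shows "measure_support mtopology \<mu> \<in> sets \<mu>" "AE x in \<mu>. x \<in> measure_support mtopology \<mu>"
proof -
  note b = borel_probsD[OF assms]
  let ?S = "measure_support mtopology \<mu>"
  obtain B where B: "countable B"
    "\<And>U x. openin mtopology U \<Longrightarrow> x \<in> U \<Longrightarrow> \<exists>(c, e)\<in>B. x \<in> mball c e \<and> mball c e \<subseteq> U"
    by (rule countable_ball_basis) (rule that)
  let ?N = "{p \<in> B. emeasure \<mu> (mball (fst p) (snd p)) = 0}"
  have eq: "UNIV - ?S = (\<Union>p\<in>?N. mball (fst p) (snd p))"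
  proof (intro equalityI subsetI)
    fix x assume "x \<in> UNIV - ?S"
    then obtain U where U: "openin mtopology U" "x \<in> U" "emeasure \<mu> U = 0"
      by (auto simp: measure_support_def not_gr_zero)
    then obtain c e where p: "(c, e) \<in> B" "x \<in> mball c e" "mball c e \<subseteq> U" using B(2) by blast
    have "emeasure \<mu> (mball c e) \<le> emeasure \<mu> U"
      using p(3) U(1) b(2) openin_borel_of by (intro emeasure_mono) auto
    then have "emeasure \<mu> (mball c e) = 0" using U(3) by simp
    then show "x \<in> (\<Union>p\<in>?N. mball (fst p) (snd p))"
      using p by (intro UN_I[of "(c, e)"]) auto
  next
    fix x assume "x \<in> (\<Union>p\<in>?N. mball (fst p) (snd p))"
    then show "x \<in> UNIV - ?S"
      using openin_mball by (fastforce simp: measure_support_def not_gr_zero)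
  qed
  have null: "(\<Union>p\<in>?N. mball (fst p) (snd p)) \<in> null_sets \<mu>"
    using B(1) mball_sets b(2) by (intro null_sets_UN') auto
  have "?S = space \<mu> - (\<Union>p\<in>?N. mball (fst p) (snd p))"
    using eq b(3) by auto
  then show "?S \<in> sets \<mu>" using sets.compl_sets[OF null_setsD2[OF null]] by (simp only:)
  show "AE x in \<mu>. x \<in> ?S"
    using AE_not_in[OF null] by eventually_elim (use eq in blast)
qed

lemma correlation_integral_eq:
  assumes "\<mu> \<in> borel_probs mtopology"
  shows "correlation_integral r \<mu> q e = (\<integral>x. measure \<mu> (mball x e) powr (q - 1) \<partial>\<mu>)"
  unfolding correlation_integral_def set_lebesgue_integral_def
proof (rule integral_cong_AE)
  note [measurable] = ball_measure_measurable[OF assms] measure_support_full(1)[OF assms]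
  show "(\<lambda>x. indicator (measure_support mtopology \<mu>) x *\<^sub>R measure \<mu> (mball x e) powr (q - 1))
    \<in> borel_measurable \<mu>" by measurable
  show "(\<lambda>x. measure \<mu> (mball x e) powr (q - 1)) \<in> borel_measurable \<mu>" by measurable
  show "AE x in \<mu>. indicator (measure_support mtopology \<mu>) x *\<^sub>R measure \<mu> (mball x e) powr (q - 1)
      = measure \<mu> (mball x e) powr (q - 1)"
    using measure_support_full(2)[OF assms] by eventually_elim simp
qed

lemma powr_integrable:
  assumes "\<mu> \<in> borel_probs mtopology" "1 < (q::real)"
    and [measurable]: "f \<in> borel_measurable \<mu>" and f: "\<And>x. 0 \<le> f x" "\<And>x. f x \<le> 1"
  shows "integrable \<mu> (\<lambda>x. f x powr (q - 1))"
proof -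
  interpret prob_space \<mu> using borel_probsD[OF assms(1)] by simp
  show ?thesis
  proof (rule integrable_const_bound[of _ 1])
    show "AE x in \<mu>. norm (f x powr (q - 1)) \<le> 1"
      using f assms(2) powr_mono2[of "q - 1" "f _" 1] by auto
  qed simp
qed

text \<open>Balls around points of the support have positive mass, and the support has full measure.
  Positivity ensures that \<open>ln\<close> in the dimension is a genuine logarithm and not the
  default value at 0.\<close>

lemma correlation_integral_pos:
  assumes \<mu>: "\<mu> \<in> borel_probs mtopology" and q: "1 < (q::real)" and e: "0 < e"
  shows "0 < correlation_integral r \<mu> q e"
proof -
  interpret prob_space \<mu> using borel_probsD[OF \<mu>] by simp
  let ?f = "\<lambda>x. measure \<mu> (mball x e) powr (q - 1)"
  have int: "integrable \<mu> ?f"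
    by (intro powr_integrable[OF \<mu> q ball_measure_measurable[OF \<mu>]]) auto
  have pos: "AE x in \<mu>. 0 < ?f x"
    using measure_support_full(2)[OF \<mu>]
  proof eventually_elim
    case (elim x)
    then have "0 < emeasure \<mu> (mball x e)"
      using e by (auto simp: measure_support_def)
    then show ?case by (simp add: emeasure_eq_measure)
  qed
  have "(\<integral>x. ?f x \<partial>\<mu>) \<noteq> 0"
  proof
    assume "(\<integral>x. ?f x \<partial>\<mu>) = 0"
    then have "AE x in \<mu>. ?f x = 0"
      using integral_nonneg_eq_0_iff_AE[OF int] by simp
    with pos have "AE x in \<mu>. False" by eventually_elim simp
    then show False by simp
  qed
  moreover have "0 \<le> (\<integral>x. ?f x \<partial>\<mu>)" by (rule integral_nonneg_AE) simp
  ultimately show ?thesis unfolding correlation_integral_eq[OF \<mu>] by linarith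
qed

text \<open>With a continuous bump in place of the indicator function of the ball, the correlation integral
  becomes continuous in \<open>\<mu>\<close>, and it changes by no more than a passage from \<open>e\<close> to \<open>e / 2\<close>.\<close>

definition soft_ball :: "real \<Rightarrow> 'x \<Rightarrow> 'x \<Rightarrow> real" where
  "soft_ball e x y = max 0 (min 1 (2 - 2 * r x y / e))"

definition soft_mass :: "'x measure \<Rightarrow> real \<Rightarrow> 'x \<Rightarrow> real" where
  "soft_mass \<mu> e x = (\<integral>y. soft_ball e x y \<partial>\<mu>)"

definition soft_correlation :: "'x measure \<Rightarrow> real \<Rightarrow> real \<Rightarrow> real" where
  "soft_correlation \<mu> q e = (\<integral>x. soft_mass \<mu> e x powr (q - 1) \<partial>\<mu>)"

lemma soft_ball_range: "0 \<le> soft_ball e x y" "soft_ball e x y \<le> 1"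
  by (auto simp: soft_ball_def)

lemma indicator_le_soft_ball:
  assumes "0 < e"
  shows "indicator (mball x (e / 2)) y \<le> soft_ball e x y"
proof (cases "r x y < e / 2")
  case True
  then have "2 * r x y / e < 1" using assms by (simp add: field_simps)
  then show ?thesis by (simp add: soft_ball_def)
qed (auto simp: soft_ball_range)

lemma soft_ball_le_indicator:
  assumes "0 < e"
  shows "soft_ball e x y \<le> indicator (mball x e) y"
proof (cases "r x y < e")
  case False
  then have "2 \<le> 2 * r x y / e" using assms by (simp add: field_simps)
  then show ?thesis by (simp add: soft_ball_def)
qed (auto simp: soft_ball_range)

lemma soft_ball_Lipschitz:
  assumes "0 < e"
  shows "\<bar>soft_ball e w x - soft_ball e w y\<bar> \<le> 2 / e * r x y"
proof -
  have "\<bar>soft_ball e w x - soft_ball e w y\<bar> \<le> \<bar>2 * r w x / e - 2 * r w y / e\<bar>"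
    unfolding soft_ball_def by linarith
  also have "2 * r w x / e - 2 * r w y / e = 2 / e * (r w x - r w y)"
    using assms by (simp add: field_simps)
  also have "\<bar>\<dots>\<bar> = 2 / e * \<bar>r w x - r w y\<bar>"
    unfolding abs_mult using assms by simp
  also have "\<dots> \<le> 2 / e * r x y"
    using assms abs_diff_le by (intro mult_left_mono) auto
  finally show ?thesis .
qed

lemma soft_ball_commute: "soft_ball e x y = soft_ball e y x"
  by (simp add: soft_ball_def commute)

lemma soft_ball_continuous:
  assumes "0 < e"
  shows "continuous_map mtopology euclideanreal (soft_ball e w)"
  by (rule Lipschitz_continuous_map[OF _ soft_ball_Lipschitz[OF assms]]) (use assms in simp)

lemma integrable_unit_interval:
  assumes "\<mu> \<in> borel_probs mtopology" "f \<in> borel_measurable \<mu>"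
    "\<And>x. 0 \<le> f x" "\<And>x. f x \<le> (1::real)"
  shows "integrable \<mu> f"
proof -
  interpret prob_space \<mu> using borel_probsD[OF assms(1)] by simp
  show ?thesis using assms by (intro integrable_const_bound[of _ 1]) auto
qed

lemma soft_ball_integrable:
  assumes "\<mu> \<in> borel_probs mtopology" "0 < e"
  shows "integrable \<mu> (soft_ball e x)"
  using continuous_map_borel_measurable[OF borel_probsD(2)[OF assms(1)] soft_ball_continuous[OF assms(2)]]
  by (rule integrable_unit_interval[OF assms(1)]) (rule soft_ball_range)+

lemma soft_mass_range:
  assumes "\<mu> \<in> borel_probs mtopology" "0 < e"
  shows "0 \<le> soft_mass \<mu> e x" "soft_mass \<mu> e x \<le> 1"
proof -
  interpret prob_space \<mu> using borel_probsD[OF assms(1)] by simp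
  show "0 \<le> soft_mass \<mu> e x" unfolding soft_mass_def using soft_ball_range
    by (intro integral_nonneg_AE) auto
  have "soft_mass \<mu> e x \<le> (\<integral>y. 1 \<partial>\<mu>)"
    unfolding soft_mass_def using soft_ball_range
    by (intro integral_mono soft_ball_integrable assms) auto
  then show "soft_mass \<mu> e x \<le> 1" by (simp add: prob_space)
qed

text \<open>The bump is symmetric, so its Lipschitz bound in the second argument passes to the
  centre. The constant \<open>2 / e\<close> is the same for every measure; this lets finitely many
  centres control all masses at once in \<open>openin_soft_correlation\<close>.\<close>

lemma soft_mass_Lipschitz:
  assumes "\<mu> \<in> borel_probs mtopology" "0 < e"
  shows "\<bar>soft_mass \<mu> e x - soft_mass \<mu> e y\<bar> \<le> 2 / e * r x y"
proof -
  interpret prob_space \<mu> using borel_probsD[OF assms(1)] by simp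
  note int = soft_ball_integrable[OF assms]
  have "\<bar>soft_mass \<mu> e x - soft_mass \<mu> e y\<bar> = \<bar>\<integral>z. soft_ball e x z - soft_ball e y z \<partial>\<mu>\<bar>"
    unfolding soft_mass_def by (simp only: Bochner_Integration.integral_diff[OF int int])
  also have "\<dots> \<le> (\<integral>z. \<bar>soft_ball e x z - soft_ball e y z\<bar> \<partial>\<mu>)"
    by (rule integral_abs_bound)
  also have "\<dots> \<le> (\<integral>z. 2 / e * r x y \<partial>\<mu>)"
  proof (rule integral_mono)
    show "integrable \<mu> (\<lambda>z. \<bar>soft_ball e x z - soft_ball e y z\<bar>)"
      by (intro integrable_abs Bochner_Integration.integrable_diff int)
    show "\<bar>soft_ball e x z - soft_ball e y z\<bar> \<le> 2 / e * r x y" for z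
      using soft_ball_Lipschitz[OF assms(2), of z x y] by (simp only: soft_ball_commute[of e z])
  qed simp
  finally show ?thesis by (simp add: prob_space)
qed

lemma soft_mass_continuous:
  assumes "\<mu> \<in> borel_probs mtopology" "0 < e"
  shows "continuous_map mtopology euclideanreal (soft_mass \<mu> e)"
  by (rule Lipschitz_continuous_map[OF _ soft_mass_Lipschitz[OF assms]]) (use assms(2) in simp)

lemma soft_mass_measurable:
  assumes "\<mu> \<in> borel_probs mtopology" "\<nu> \<in> borel_probs mtopology" "0 < e"
  shows "soft_mass \<mu> e \<in> borel_measurable \<nu>"
  by (rule continuous_map_borel_measurable[OF borel_probsD(2)[OF assms(2)]
        soft_mass_continuous[OF assms(1,3)]])

lemma ball_le_soft_mass:
  assumes "\<mu> \<in> borel_probs mtopology" "0 < e"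
  shows "measure \<mu> (mball x (e / 2)) \<le> soft_mass \<mu> e x"
proof -
  interpret prob_space \<mu> using borel_probsD[OF assms(1)] by simp
  have [measurable]: "mball x (e / 2) \<in> sets \<mu>"
    using mball_sets borel_probsD(2)[OF assms(1)] by simp
  have int: "integrable \<mu> (indicator (mball x (e / 2)) :: _ \<Rightarrow> real)"
    by (rule integrable_real_indicator) (simp_all add: emeasure_eq_measure)
  have "measure \<mu> (mball x (e / 2)) = (\<integral>y. indicator (mball x (e / 2)) y \<partial>\<mu>)"
    using borel_probsD(3)[OF assms(1)] by simp
  also have "\<dots> \<le> soft_mass \<mu> e x"
    unfolding soft_mass_def
    by (intro integral_mono soft_ball_integrable indicator_le_soft_ball assms int)
  finally show ?thesis .
qed

lemma soft_mass_le_ball: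
  assumes "\<mu> \<in> borel_probs mtopology" "0 < e"
  shows "soft_mass \<mu> e x \<le> measure \<mu> (mball x e)"
proof -
  interpret prob_space \<mu> using borel_probsD[OF assms(1)] by simp
  have [measurable]: "mball x e \<in> sets \<mu>"
    using mball_sets borel_probsD(2)[OF assms(1)] by simp
  have int: "integrable \<mu> (indicator (mball x e) :: _ \<Rightarrow> real)"
    by (rule integrable_real_indicator) (simp_all add: emeasure_eq_measure)
  have "soft_mass \<mu> e x \<le> (\<integral>y. indicator (mball x e) y \<partial>\<mu>)"
    unfolding soft_mass_def
    by (intro integral_mono soft_ball_integrable soft_ball_le_indicator assms int)
  also have "\<dots> = measure \<mu> (mball x e)"
    using borel_probsD(3)[OF assms(1)] by simp
  finally show ?thesis .
qed

section \<open>Bounds for the soft correlation and the criterion for infinite dimension\<close>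

lemma soft_correlation_integrable:
  assumes "\<mu> \<in> borel_probs mtopology" "\<nu> \<in> borel_probs mtopology" "0 < e" "1 < q"
  shows "integrable \<nu> (\<lambda>x. soft_mass \<mu> e x powr (q - 1))"
  using assms by (intro powr_integrable soft_mass_measurable soft_mass_range)

lemma soft_correlation_bounds:
  assumes "\<mu> \<in> borel_probs mtopology" "0 < e" "1 < q"
  shows "correlation_integral r \<mu> q (e / 2) \<le> soft_correlation \<mu> q e"
    "soft_correlation \<mu> q e \<le> correlation_integral r \<mu> q e"
proof -
  interpret prob_space \<mu> using borel_probsD[OF assms(1)] by simp
  have int: "integrable \<mu> (\<lambda>x. measure \<mu> (mball x d) powr (q - 1))" for d
    using assms(3) by (intro powr_integrable ball_measure_measurable assms) auto
  show "correlation_integral r \<mu> q (e / 2) \<le> soft_correlation \<mu> q e"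
    unfolding correlation_integral_eq[OF assms(1)] soft_correlation_def
    using assms by (intro integral_mono int soft_correlation_integrable powr_mono2 ball_le_soft_mass) auto
  show "soft_correlation \<mu> q e \<le> correlation_integral r \<mu> q e"
    unfolding correlation_integral_eq[OF assms(1)] soft_correlation_def
    using assms by (intro integral_mono int soft_correlation_integrable powr_mono2 soft_mass_le_ball
        soft_mass_range) auto
qed

lemma soft_correlation_le:
  assumes "\<mu> \<in> borel_probs mtopology" "0 < e" "1 < q" "\<And>x. measure \<mu> (mball x e) \<le> c"
  shows "soft_correlation \<mu> q e \<le> c powr (q - 1)"
proof -
  interpret prob_space \<mu> using borel_probsD[OF assms(1)] by simp
  have "soft_correlation \<mu> q e \<le> (\<integral>x. c powr (q - 1) \<partial>\<mu>)"
    unfolding soft_correlation_def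
    using assms(2,3) order_trans[OF soft_mass_le_ball[OF assms(1,2)] assms(4)]
    by (intro integral_mono soft_correlation_integrable powr_mono2 soft_mass_range assms(1)) auto
  then show ?thesis by (simp add: prob_space)
qed

text \<open>For \<open>e < 1\<close> the denominator \<open>(q - 1) * ln e\<close> is negative, so a
  quotient above \<open>n / (q - 1)\<close> means a correlation integral below \<open>e ^ n\<close>.
  Since \<open>n\<close> is arbitrary, the factor \<open>q - 1\<close> and the passage from
  \<open>e\<close> to \<open>e / 2\<close> only change exponents.\<close>

lemma upper_gen_dim_infinite_iff:
  assumes \<mu>: "\<mu> \<in> borel_probs mtopology" and q: "1 < q"
  shows "upper_gen_dim r \<mu> q = \<infinity> \<longleftrightarrow>
    (\<forall>n. \<exists>e. 0 < e \<and> e < 1 / real (Suc n) \<and> soft_correlation \<mu> q e < e ^ n)"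
proof
  let ?F = "\<lambda>e. ereal (ln (correlation_integral r \<mu> q e) / ((q - 1) * ln e))"
  assume inf: "upper_gen_dim r \<mu> q = \<infinity>"
  show "\<forall>n. \<exists>e. 0 < e \<and> e < 1 / real (Suc n) \<and> soft_correlation \<mu> q e < e ^ n"
  proof
    fix n
    have "\<exists>\<^sub>F e in at_right 0. ereal (real n / (q - 1)) < ?F e"
    proof (rule ccontr)
      assume "\<not> ?thesis"
      then have "\<forall>\<^sub>F e in at_right 0. ?F e \<le> ereal (real n / (q - 1))"
        by (simp add: not_frequently not_less)
      then have "Limsup (at_right 0) ?F \<le> ereal (real n / (q - 1))"
        by (rule Limsup_bounded)
      then show False using inf by (simp add: upper_gen_dim_def)
    qed
    moreover have "\<forall>\<^sub>F e in at_right (0::real). e < 1 / real (Suc n)"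
      by (intro eventually_at_right_less[THEN eventually_mono] eventually_at_rightI[of 0 "1 / real (Suc n)"]) auto
    moreover have "\<forall>\<^sub>F e in at_right (0::real). 0 < e" by (rule eventually_at_right_less)
    ultimately have "\<exists>\<^sub>F e in at_right 0. (ereal (real n / (q - 1)) < ?F e \<and> e < 1 / real (Suc n)) \<and> 0 < e"
      by (intro frequently_eventually_frequently)
    then obtain e where e: "ereal (real n / (q - 1)) < ?F e" "e < 1 / real (Suc n)" "0 < e"
      using frequently_ex by blast
    let ?I = "correlation_integral r \<mu> q e"
    have I: "0 < ?I" using correlation_integral_pos[OF \<mu> q e(3)] .
    have "1 / real (Suc n) \<le> 1" by simp
    then have "e < 1" using e(2) by linarith
    then have "(q - 1) * ln e < 0" using e(3) q by (simp add: mult_pos_neg)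
    then have "ln ?I < real n / (q - 1) * ((q - 1) * ln e)"
      using e(1) by (simp only: less_ereal.simps neg_less_divide_eq)
    also have "\<dots> = real n * ln e" using q by simp
    also have "\<dots> = ln (e ^ n)" using e(3) by (simp only: ln_realpow)
    finally have "?I < e ^ n" using I e(3) by (simp only: ln_less_cancel_iff zero_less_power)
    then show "\<exists>e. 0 < e \<and> e < 1 / real (Suc n) \<and> soft_correlation \<mu> q e < e ^ n"
      using soft_correlation_bounds(2)[OF \<mu> e(3) q] e by (intro exI[of _ e]) auto
  qed
next
  let ?F = "\<lambda>e. ereal (ln (correlation_integral r \<mu> q e) / ((q - 1) * ln e))"
  assume R: "\<forall>n. \<exists>e. 0 < e \<and> e < 1 / real (Suc n) \<and> soft_correlation \<mu> q e < e ^ n"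
  show "upper_gen_dim r \<mu> q = \<infinity>"
  proof (rule ccontr)
    assume "upper_gen_dim r \<mu> q \<noteq> \<infinity>"
    then obtain C :: nat where "Limsup (at_right 0) ?F < ereal (real C)"
      unfolding upper_gen_dim_def by (auto simp: less_PInf_Ex_of_nat)
    then have "\<forall>\<^sub>F e in at_right 0. ?F e < ereal (real C)" by (rule Limsup_lessD)
    then obtain d where d: "d > 0" "\<And>e. 0 < e \<Longrightarrow> e < d \<Longrightarrow> ?F e < ereal (real C)"
      by (auto simp: eventually_at_right_field)
    obtain m :: nat where m: "1 / real (Suc m) < d" using d(1) nat_approx_posE by blast
    \<comment> \<open>The factor 2 pays for halving the scale: \<open>ln (e / 2)\<close> is at least
      \<open>2 * ln e\<close> once \<open>e < 1 / 2\<close>.\<close>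
    obtain k :: nat where k: "2 * real C * (q - 1) \<le> real k" using real_arch_simple by blast
    \<comment> \<open>One index does three jobs: the part \<open>m\<close> forces
      \<open>e < d\<close>, the part \<open>k\<close> makes the exponent large, and the successor
      forces \<open>e < 1 / 2\<close>.\<close>
    let ?n = "Suc (m + k)"
    obtain e where e: "0 < e" "e < 1 / real (Suc ?n)" "soft_correlation \<mu> q e < e ^ ?n"
      using R by blast
    have "1 / real (Suc ?n) \<le> 1 / real (Suc m)" "1 / real (Suc ?n) \<le> 1 / 2"
      by (auto simp: field_simps)
    then have e2: "e < d" "e < 1 / 2" using e m by linarith+
    let ?I = "correlation_integral r \<mu> q (e / 2)"
    have I: "0 < ?I" using correlation_integral_pos[OF \<mu> q] e by simp
    have "?I < e ^ ?n" using soft_correlation_bounds(1)[OF \<mu> e(1) q] e(3) by linarith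
    then have "ln ?I < ln (e ^ ?n)" using I e by (subst ln_less_cancel_iff) auto
    then have up: "ln ?I < real ?n * ln e" using e(1) by (simp only: ln_realpow)
    have "ln e \<le> ln (1 / 2)" using e(1) e2(2) by (subst ln_le_cancel_iff) auto
    then have le: "ln e \<le> - ln 2" using ln_divide_pos[of 1 "2::real"] by simp
    have half: "ln (e / 2) = ln e - ln 2" using e(1) by (intro ln_divide_pos) auto
    have "ln e < 0" using e(1) e2(2) by (intro ln_less_zero) auto
    have neg: "ln (e / 2) < 0" using e(1) e2(2) by (intro ln_less_zero) auto
    have "ln ?I / ((q - 1) * ln (e / 2)) < real C" using d(2)[of "e / 2"] e e2 by simp
    then have "real C * ((q - 1) * ln (e / 2)) < ln ?I"
      using neg q by (subst (asm) neg_divide_less_eq) (auto simp: mult_pos_neg)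
    moreover have "real C * ((q - 1) * (2 * ln e)) \<le> real C * ((q - 1) * ln (e / 2))"
      using half le q by (intro mult_left_mono) auto
    moreover have "real ?n * ln e \<le> (2 * real C * (q - 1)) * ln e"
      using k \<open>ln e < 0\<close> by (intro mult_right_mono_neg) auto
    moreover have "real C * ((q - 1) * (2 * ln e)) = (2 * real C * (q - 1)) * ln e" by simp
    ultimately show False using up by linarith
  qed
qed

section \<open>The weak topology: open conditions and closures\<close>

lemma openin_weak_topology_basic:
  assumes "continuous_map mtopology euclideanreal f" "open U"
  shows "openin (weak_topology mtopology S) {\<mu> \<in> S. (\<integral>x. f x \<partial>\<mu>) \<in> U}"
proof -
  \<comment> \<open>Compactness makes every continuous test function bounded, as the definition of
    the weak topology demands.\<close>
  have "compactin euclideanreal (f ` topspace mtopology)"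
    using image_compactin[OF _ assms(1)] compact unfolding compact_space_def by blast
  then have "bounded (f ` topspace mtopology)"
    by (simp add: compact_imp_bounded)
  then show ?thesis
    unfolding weak_topology_def using assms by (intro topology_generated_by_Basis) blast
qed

lemma openin_weak_topology_near:
  assumes "continuous_map mtopology euclideanreal f"
  shows "openin (weak_topology mtopology S) {\<mu> \<in> S. \<bar>(\<integral>x. f x \<partial>\<mu>) - c\<bar> < e}"
  using openin_weak_topology_basic[OF assms open_ball[of c e], of S]
  by (simp add: dist_real_def abs_minus_commute)

text \<open>The measure enters twice, as integrator and inside the integrand. Freezing the integrand
  at \<open>\<mu>\<close> leaves the integral of a fixed continuous function; the change of the
  integrand is uniformly small once the soft masses at finitely many net points are close, by the
  common Lipschitz bound.\<close>

lemma openin_soft_correlation: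
  assumes S: "S \<subseteq> borel_probs mtopology" and q: "1 < q" and e: "0 < e"
  shows "openin (weak_topology mtopology S) {\<mu> \<in> S. soft_correlation \<mu> q e < c}"
proof (subst openin_subopen, intro ballI)
  fix \<mu> assume "\<mu> \<in> {\<mu> \<in> S. soft_correlation \<mu> q e < c}"
  then have \<mu>: "\<mu> \<in> S" "\<mu> \<in> borel_probs mtopology" and less: "soft_correlation \<mu> q e < c"
    using S by auto
  \<comment> \<open>Half of the gap is spent on changing the integrand, half on changing the
    integrator.\<close>
  define \<eta> where "\<eta> = (c - soft_correlation \<mu> q e) / 2"
  have \<eta>: "0 < \<eta>" using less by (simp add: \<eta>_def)
  have "continuous_on {0..1} (\<lambda>t::real. t powr (q - 1))"
    using q by (intro continuous_on_powr' continuous_intros) auto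
  \<comment> \<open>For \<open>q < 2\<close> the power is not Lipschitz at 0, so compactness of the
    unit interval supplies the modulus.\<close>
  then have "uniformly_continuous_on {0..1} (\<lambda>t::real. t powr (q - 1))"
    by (intro compact_uniformly_continuous) auto
  then obtain d where d: "0 < d"
    "\<And>s t. s \<in> {0..1} \<Longrightarrow> t \<in> {0..1} \<Longrightarrow> \<bar>s - t\<bar> < d \<Longrightarrow> \<bar>s powr (q - 1) - t powr (q - 1)\<bar> < \<eta>"
    using \<eta> unfolding uniformly_continuous_on_def dist_real_def by metis
  \<comment> \<open>At this distance from a net point the Lipschitz constant \<open>2 / e\<close>
    allows a change below \<open>d / 3\<close>; three such errors make up \<open>d\<close>.\<close>
  have "0 < d * e / 6" using d(1) e by simp
  then obtain K where K: "finite K" "\<And>x. \<exists>w\<in>K. r w x < d * e / 6" using finite_net by metis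
  let ?h = "\<lambda>x. soft_mass \<mu> e x powr (q - 1)"
  have h: "continuous_map mtopology euclideanreal ?h"
  proof -
    have "continuous_map mtopology euclideanreal ((\<lambda>t. t powr (q - 1)) \<circ> soft_mass \<mu> e)"
    proof (rule continuous_map_compose)
      show "continuous_map mtopology (top_of_set {0..1}) (soft_mass \<mu> e)"
        using soft_mass_continuous[OF \<mu>(2) e] soft_mass_range[OF \<mu>(2) e]
        by (simp add: continuous_map_in_subtopology image_subset_iff)
      show "continuous_map (top_of_set {0..1}) euclideanreal (\<lambda>t. t powr (q - 1))"
        using \<open>continuous_on {0..1} (\<lambda>t::real. t powr (q - 1))\<close> by simp
    qed
    then show ?thesis by (simp add: o_def)
  qed
  define V where "V = {\<nu> \<in> S. \<bar>(\<integral>x. ?h x \<partial>\<nu>) - soft_correlation \<mu> q e\<bar> < \<eta>}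
    \<inter> (\<Inter>w\<in>K. {\<nu> \<in> S. \<bar>(\<integral>x. soft_ball e w x \<partial>\<nu>) - soft_mass \<mu> e w\<bar> < d / 3})"
  have "K \<noteq> {}" using K(2) by blast
  then have "openin (weak_topology mtopology S) V"
    unfolding V_def using K(1)
    by (intro openin_Int openin_INT2 openin_weak_topology_near h soft_ball_continuous e)
  moreover have "\<mu> \<in> V"
    using \<mu>(1) \<eta> d(1) by (simp add: V_def soft_correlation_def flip: soft_mass_def)
  moreover have "V \<subseteq> {\<mu> \<in> S. soft_correlation \<mu> q e < c}"
  proof
    fix \<nu> assume V: "\<nu> \<in> V"
    then have \<nu>: "\<nu> \<in> S" "\<nu> \<in> borel_probs mtopology" using S by (auto simp: V_def)
    interpret prob_space \<nu> using borel_probsD[OF \<nu>(2)] by simp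
    have close: "\<bar>soft_mass \<nu> e x - soft_mass \<mu> e x\<bar> < d" for x
    proof -
      obtain w where w: "w \<in> K" "r w x < d * e / 6" using K(2) by blast
      have "2 / e * r w x < d / 3" using w(2) e by (simp add: field_simps)
      then have "\<bar>soft_mass \<nu> e w - soft_mass \<nu> e x\<bar> < d / 3" "\<bar>soft_mass \<mu> e w - soft_mass \<mu> e x\<bar> < d / 3"
        using soft_mass_Lipschitz[OF \<nu>(2) e, of w x] soft_mass_Lipschitz[OF \<mu>(2) e, of w x] by linarith+
      moreover have "\<bar>soft_mass \<nu> e w - soft_mass \<mu> e w\<bar> < d / 3"
        using V w(1) by (auto simp: V_def soft_mass_def[of \<nu>])
      ultimately show ?thesis by linarith
    qed
    have le: "soft_mass \<nu> e x powr (q - 1) \<le> ?h x + \<eta>" for x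
      using d(2)[OF _ _ close[of x]] soft_mass_range[OF \<nu>(2) e, of x] soft_mass_range[OF \<mu>(2) e, of x]
      by force
    have int: "integrable \<nu> ?h" by (rule soft_correlation_integrable[OF \<mu>(2) \<nu>(2) e q])
    have "soft_correlation \<nu> q e \<le> (\<integral>x. ?h x + \<eta> \<partial>\<nu>)"
      unfolding soft_correlation_def using le
      by (intro integral_mono soft_correlation_integrable \<nu> e q Bochner_Integration.integrable_add int) auto
    also have "\<dots> = (\<integral>x. ?h x \<partial>\<nu>) + \<eta>"
      using int by (simp add: prob_space)
    also have "\<dots> < soft_correlation \<mu> q e + \<eta> + \<eta>" using V by (auto simp: V_def)
    also have "\<dots> = c" by (simp add: \<eta>_def)
    finally show "\<nu> \<in> {\<mu> \<in> S. soft_correlation \<mu> q e < c}" using \<nu> by simp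
  qed
  ultimately show "\<exists>V. openin (weak_topology mtopology S) V \<and> \<mu> \<in> V
      \<and> V \<subseteq> {\<mu> \<in> S. soft_correlation \<mu> q e < c}" by blast
qed

text \<open>For each \<open>n\<close> the union over all small \<open>e\<close> is uncountable but
  consists of open sets; only the intersection over \<open>n\<close> has to be countable.\<close>

lemma gdelta_in_infinite_dim:
  assumes S: "S \<subseteq> borel_probs mtopology" and q: "1 < q"
  shows "gdelta_in (weak_topology mtopology S) {\<mu> \<in> S. upper_gen_dim r \<mu> q = \<infinity>}"
proof -
  define G where "G n = (\<Union>e\<in>{0<..<1 / real (Suc n)}. {\<mu> \<in> S. soft_correlation \<mu> q e < e ^ n})" for n
  have "openin (weak_topology mtopology S) (G n)" for n
    unfolding G_def by (intro openin_Union ballI) (auto intro: openin_soft_correlation[OF S q])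
  then have "gdelta_in (weak_topology mtopology S) (\<Inter>(range G))"
    by (intro gdelta_in_Inter) (auto intro: open_imp_gdelta_in)
  moreover have "{\<mu> \<in> S. upper_gen_dim r \<mu> q = \<infinity>} = \<Inter>(range G)"
  proof (rule set_eqI)
    fix \<mu>
    show "\<mu> \<in> {\<mu> \<in> S. upper_gen_dim r \<mu> q = \<infinity>} \<longleftrightarrow> \<mu> \<in> \<Inter>(range G)"
      using upper_gen_dim_infinite_iff[of \<mu> q] S q by (auto simp: G_def Bex_def)
  qed
  ultimately show ?thesis by simp
qed

text \<open>The hypothesis holds when \<open>\<nu>\<close> arises from \<open>\<mu>\<close> by displacing points by less than \<open>d\<close>.\<close>

lemma in_closure_of_weak_topology:
  assumes \<mu>: "\<mu> \<in> S" and C: "C \<subseteq> S"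
    and approx: "\<And>d. 0 < d \<Longrightarrow> \<exists>\<nu>\<in>C. \<forall>f \<eta>. continuous_map mtopology euclideanreal f \<longrightarrow>
      (\<forall>x y. r x y < d \<longrightarrow> \<bar>f x - f y\<bar> < \<eta>) \<longrightarrow> \<bar>(\<integral>x. f x \<partial>\<mu>) - (\<integral>x. f x \<partial>\<nu>)\<bar> \<le> \<eta>"
  shows "\<mu> \<in> weak_topology mtopology S closure_of C"
proof -
  define near where "near d \<nu> \<longleftrightarrow> (\<forall>f \<eta>. continuous_map mtopology euclideanreal f \<longrightarrow>
      (\<forall>x y. r x y < d \<longrightarrow> \<bar>f x - f y\<bar> < \<eta>) \<longrightarrow> \<bar>(\<integral>x. f x \<partial>\<mu>) - (\<integral>x. f x \<partial>\<nu>)\<bar> \<le> \<eta>)" for d \<nu>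
  have near_mono: "near d \<nu>" if "near d' \<nu>" "d' \<le> d" for d d' \<nu>
    using that unfolding near_def by (meson less_le_trans)
  \<comment> \<open>The topology is given by a subbase, so the claim is proved by induction on the
    generation of \<open>W\<close>. Binary intersections take the minimum of two distances, because
    \<open>near\<close> gets stronger as \<open>d\<close> shrinks.\<close>
  have nbhd: "\<exists>d>0. \<forall>\<nu>\<in>S. near d \<nu> \<longrightarrow> \<nu> \<in> W"
    if "generate_topology_on {{\<mu> \<in> S. (\<integral>x. f x \<partial>\<mu>) \<in> U} | f U.
        continuous_map mtopology euclideanreal f \<and> bounded (f ` topspace mtopology) \<and> open U} W"
      "\<mu> \<in> W" for W
    using that
  proof (induction rule: generate_topology_on.induct)
    case (Int a b)
    then obtain d e where "0 < d" "\<forall>\<nu>\<in>S. near d \<nu> \<longrightarrow> \<nu> \<in> a" "0 < e" "\<forall>\<nu>\<in>S. near e \<nu> \<longrightarrow> \<nu> \<in> b"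
      by auto
    then show ?case
      using near_mono by (intro exI[of _ "min d e"]) (meson IntI min.cobounded1 min.cobounded2 min_less_iff_conj)
  next
    case (UN K)
    then obtain k where "k \<in> K" "\<mu> \<in> k" by blast
    then show ?case using UN(2)[of k] by blast
  next
    case (Basis s)
    then obtain f U where f: "s = {\<mu> \<in> S. (\<integral>x. f x \<partial>\<mu>) \<in> U}"
      "continuous_map mtopology euclideanreal f" "open U" by blast
    then obtain \<eta> where \<eta>: "0 < \<eta>" "\<And>t. dist t (\<integral>x. f x \<partial>\<mu>) < \<eta> \<Longrightarrow> t \<in> U"
      using Basis(2) by (auto simp: open_dist)
    obtain d where d: "0 < d" "\<forall>x y. r x y < d \<longrightarrow> \<bar>f x - f y\<bar> < \<eta> / 2"
      using uniformly_continuous[OF f(2), of "\<eta> / 2"] \<eta>(1) by auto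
    have "(\<integral>x. f x \<partial>\<nu>) \<in> U" if "near d \<nu>" for \<nu>
    proof -
      \<comment> \<open>Integration turns the strict pointwise bound into a weak one; using half of
        \<open>\<eta>\<close> restores strictness.\<close>
      have "\<bar>(\<integral>x. f x \<partial>\<mu>) - (\<integral>x. f x \<partial>\<nu>)\<bar> \<le> \<eta> / 2"
        using that d(2) f(2) unfolding near_def by blast
      then show ?thesis using \<eta> by (intro \<eta>(2)) (unfold dist_real_def, linarith)
    qed
    then show ?case using f(1) d(1) by auto
  qed auto
  show ?thesis
    unfolding in_closure_of topspace_weak_topology
  proof (intro conjI allI impI)
    fix W assume "\<mu> \<in> W \<and> openin (weak_topology mtopology S) W"
    then obtain d where d: "0 < d" "\<forall>\<nu>\<in>S. near d \<nu> \<longrightarrow> \<nu> \<in> W"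
      using nbhd[of W] by (auto simp: weak_topology_def openin_topology_generated_by_iff)
    then show "\<exists>y. y \<in> C \<and> y \<in> W"
      using approx[OF d(1)] C unfolding near_def by blast
  qed (rule \<mu>)
qed

end

section \<open>Random perturbations in the full shift\<close>

text \<open>\<open>p\<close> sends a point to a nearby centre of a finite net, and \<open>p'\<close>
  sends it to a chosen neighbour of that centre, distinct from it by perfectness. With finitely many
  centres the separation has a positive minimum.\<close>

lemma two_point_perturbation:
  fixes d :: real
  assumes "compact (UNIV :: 'a::{metric_space, perfect_space} set)" "0 < d"
  obtains p p' :: "'a::{metric_space, perfect_space} \<Rightarrow> 'a" and \<rho> :: real
  where "p \<in> borel_measurable borel" "p' \<in> borel_measurable borel" "0 < \<rho>"
    "\<And>z. dist z (p z) < d" "\<And>z. dist z (p' z) < d" "\<And>z. 2 * \<rho> \<le> dist (p z) (p' z)"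
proof -
  obtain K where K: "finite K" "(UNIV :: 'a set) \<subseteq> (\<Union>x\<in>K. ball x (d / 2))"
    using assms unfolding compact_eq_totally_bounded by (meson half_gt_zero)
  obtain c :: "nat \<Rightarrow> 'a" and N where c: "K = c ` {i. i < N}"
    using finite_imp_nat_seg_image_inj_on[OF K(1)] by metis
  have "\<exists>y. y \<noteq> x \<and> dist y x < d / 2" for x :: 'a
    using perfect_choose_dist[of "d / 2" x] assms(2) by simp
  then obtain s :: "'a \<Rightarrow> 'a" where s: "\<And>x. s x \<noteq> x" "\<And>x. dist (s x) x < d / 2" by metis
  \<comment> \<open>Taking the first suitable centre makes the choice measurable, since each
    condition defines an open set.\<close>
  define idx where "idx z = (LEAST i. dist (c i) z < d / 2)" for z
  have ex: "\<exists>i<N. dist (c i) z < d / 2" for z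
    using K(2) unfolding c by (auto simp: subset_iff)
  then have idx: "dist (c (idx z)) z < d / 2" for z
    unfolding idx_def by (metis (mono_tags, lifting) LeastI)
  have less: "idx z < N" for z
    using ex[of z] unfolding idx_def by (metis (mono_tags, lifting) Least_le le_less_trans)
  have meas: "idx \<in> measurable borel (count_space UNIV)"
    unfolding idx_def
  proof (rule measurable_Least)
    fix i
    have "open {z. dist (c i) z < d / 2}" by (intro open_Collect_less continuous_intros)
    then show "(\<lambda>z. dist (c i) z < d / 2) \<in> measurable borel (count_space UNIV)"
      unfolding pred_def by simp
  qed
  \<comment> \<open>Inserting 1 makes the set visibly nonempty; halving leaves room for two disjoint
    balls of radius \<open>\<rho>\<close>.\<close>
  define \<rho> where "\<rho> = Min (insert 1 ((\<lambda>x. dist x (s x) / 2) ` K))"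
  have pos: "0 < \<rho>"
    unfolding \<rho>_def using K(1) s(1)[symmetric] by (subst Min_gr_iff) auto
  show ?thesis
  proof (rule that[of "\<lambda>z. c (idx z)" "\<lambda>z. s (c (idx z))" \<rho>])
    show "(\<lambda>z. c (idx z)) \<in> borel_measurable borel" "(\<lambda>z. s (c (idx z))) \<in> borel_measurable borel"
      by (rule measurable_compose[OF meas], simp)+
    show "dist z (c (idx z)) < d" for z
      using idx[of z] assms(2) dist_commute[of z] by simp
    show "dist z (s (c (idx z))) < d" for z
      using dist_triangle[of z "s (c (idx z))" "c (idx z)"] idx[of z] s(2)[of "c (idx z)"]
      by (simp add: dist_commute)
    have "c (idx z) \<in> K" for z using less[of z] c by auto
    then have "\<rho> \<le> dist (c (idx z)) (s (c (idx z))) / 2" for z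
      unfolding \<rho>_def using K(1) by (intro Min_le) auto
    then show "2 * \<rho> \<le> dist (c (idx z)) (s (c (idx z)))" for z
      by (metis field_sum_of_halves add_mono mult_2)
  qed (rule pos)
qed

section \<open>Independent fair coin flips\<close>

definition coin_flips :: "(int \<Rightarrow> bool) measure" where
  "coin_flips = (\<Pi>\<^sub>M i\<in>UNIV. measure_pmf (bernoulli_pmf (1 / 2)))"

interpretation coin_flips: product_prob_space "\<lambda>_. measure_pmf (bernoulli_pmf (1 / 2))" UNIV
  by (rule product_prob_spaceI) (rule measure_pmf.prob_space_axioms)

lemma prob_space_coin_flips: "prob_space coin_flips"
  unfolding coin_flips_def by (rule coin_flips.P.prob_space_axioms)

lemma space_coin_flips [simp]: "space coin_flips = UNIV"
  by (simp add: coin_flips_def space_PiM)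

lemma coin_measurable: "(\<lambda>b. b n) \<in> measurable coin_flips (count_space UNIV)"
proof -
  have "(\<lambda>b. b n) \<in> measurable coin_flips (measure_pmf (bernoulli_pmf (1 / 2)))"
    unfolding coin_flips_def by (rule measurable_component_singleton) simp
  then show ?thesis by simp
qed

text \<open>The factors of the product are identical, so an injective reindexing, here
  \<open>n\<close> to \<open>n - 1\<close>, preserves the product measure.\<close>

lemma full_shift_coin_flips:
  "full_shift \<in> measurable coin_flips coin_flips" "distr coin_flips coin_flips full_shift = coin_flips"
proof -
  have eq: "(\<lambda>\<omega>. \<lambda>n\<in>UNIV. \<omega> (n - 1)) = (full_shift :: (int \<Rightarrow> bool) \<Rightarrow> _)"
    by (simp add: full_shift_def fun_eq_iff)
  show "full_shift \<in> measurable coin_flips coin_flips"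
    unfolding eq[symmetric] coin_flips_def
    by (intro measurable_restrict measurable_component_singleton) simp
  show "distr coin_flips coin_flips full_shift = coin_flips"
    using distr_PiM_reindex[of UNIV "\<lambda>_. measure_pmf (bernoulli_pmf (1 / 2))" "\<lambda>n::int. n - 1" UNIV]
    unfolding eq coin_flips_def[symmetric]
    by (simp add: inj_on_def measure_pmf.prob_space_axioms)
qed

text \<open>Each \<open>E n\<close> misses an outcome and so has probability at most one half;
  independence multiplies these bounds.\<close>

lemma emeasure_coin_flips_le:
  assumes "finite J" "\<And>n. n \<in> J \<Longrightarrow> E n \<noteq> UNIV"
  shows "emeasure coin_flips {b. \<forall>n\<in>J. b n \<in> E n} \<le> ennreal ((1 / 2) ^ card J)"
proof -
  have half: "emeasure (measure_pmf (bernoulli_pmf (1 / 2))) A \<le> ennreal (1 / 2)" if A: "A \<noteq> UNIV" for A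
  proof -
    obtain b where b: "b \<notin> A" using A by blast
    then have "A \<subseteq> {\<not> b}" by (cases b) (auto, metis)
    then have "emeasure (measure_pmf (bernoulli_pmf (1 / 2))) A
        \<le> emeasure (measure_pmf (bernoulli_pmf (1 / 2))) {\<not> b}" by (intro emeasure_mono) auto
    also have "\<dots> = ennreal (1 / 2)" by (cases b) (simp_all add: emeasure_pmf_single)
    finally show ?thesis .
  qed
  have "emeasure coin_flips {b. \<forall>n\<in>J. b n \<in> E n}
      = (\<Prod>n\<in>J. emeasure (measure_pmf (bernoulli_pmf (1 / 2))) (E n))"
    using coin_flips.emeasure_PiM_Collect[of J E] assms(1)
    by (simp add: coin_flips_def space_PiM)
  also have "\<dots> \<le> (\<Prod>n\<in>J. ennreal (1 / 2))" using half assms(2) by (intro prod_mono_ennreal) auto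
  also have "\<dots> = ennreal ((1 / 2) ^ card J)" by (simp only: prod_constant ennreal_power)
  finally show ?thesis .
qed

section \<open>The metric of the shift space: compactness and measurability\<close>

locale shift_space =
  fixes a :: "nat \<Rightarrow> real" and r :: "(int \<Rightarrow> 'a :: {metric_space, perfect_space}) \<Rightarrow> (int \<Rightarrow> 'a) \<Rightarrow> real"
  assumes base_compact: "compact (UNIV :: 'a set)"
    and a_nonneg: "\<And>k. 0 \<le> a k"
    and a_summable: "summable (\<lambda>k. 1 / (a k + 1))"
    and r_eq: "r = seq_metric a"
begin

definition weight :: "int \<Rightarrow> real" where "weight n = 1 / (a (nat \<bar>n\<bar>) + 1)"

lemma weight_pos: "0 < weight n"
  using a_nonneg[of "nat \<bar>n\<bar>"] by (simp add: weight_def)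

lemma weight_summable: "weight summable_on UNIV"
  using summable_on_int_abs[OF a_summable] a_nonneg by (simp add: weight_def[abs_def])

lemma terms_summable: "(\<lambda>n. min (weight n) (dist (x n) (y n))) summable_on UNIV"
  unfolding weight_def using seq_metric_summable[OF a_nonneg a_summable] .

lemma r_infsum: "r x y = (\<Sum>\<^sub>\<infinity>n. min (weight n) (dist (x n) (y n)))"
  by (simp add: r_eq seq_metric_def weight_def)

text \<open>Used to read off coordinates: a ball of radius at most \<open>weight n\<close> confines
  the coordinate \<open>n\<close> to a ball of the same radius.\<close>

lemma term_le_r: "min (weight n) (dist (x n) (y n)) \<le> r x y"
  unfolding r_infsum
  using finite_sum_le_infsum[OF terms_summable, of "{n}" x y] weight_pos
  by (simp add: less_imp_le)

text \<open>Outside a finite \<open>F\<close> the weights sum to at most \<open>e / 3\<close>,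
  whatever the points are; inside \<open>F\<close> closeness of the coordinates contributes at most
  another \<open>e / 3\<close>.\<close>

lemma r_small:
  assumes "0 < e"
  shows "\<exists>F d. finite F \<and> 0 < d \<and> (\<forall>x y. (\<forall>n\<in>F. dist (x n) (y n) < d) \<longrightarrow> r x y < e)"
proof -
  obtain F where F: "finite F" "dist (sum weight F) (infsum weight UNIV) \<le> e / 3"
    using infsum_finite_approximation[OF weight_summable, of "e / 3"] assms by auto
  have split: "infsum f UNIV = sum f F + infsum f (- F)" if "f summable_on UNIV" for f :: "int \<Rightarrow> real"
    using infsum_Un_disjoint[of f F "- F"] F(1) summable_on_subset_banach[OF that] by simp
  have tail: "infsum weight (- F) \<le> e / 3"
    using F(2) split[OF weight_summable] by (simp add: dist_real_def)
  \<comment> \<open>The successor avoids division by zero when \<open>F\<close> is empty.\<close>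
  define d where "d = e / (3 * real (Suc (card F)))"
  have d: "0 < d" using assms by (simp add: d_def)
  have "r x y < e" if "\<forall>n\<in>F. dist (x n) (y n) < d" for x y
  proof -
    let ?t = "\<lambda>n. min (weight n) (dist (x n) (y n))"
    have "sum ?t F \<le> (\<Sum>n\<in>F. d)" using that by (intro sum_mono) (auto intro: min.coboundedI2 less_imp_le)
    also have "\<dots> = real (card F) * d" by simp
    also have "\<dots> \<le> e / 3" using assms by (simp add: d_def field_simps)
    finally have "sum ?t F \<le> e / 3" .
    moreover have "infsum ?t (- F) \<le> infsum weight (- F)"
      by (intro infsum_mono summable_on_subset_banach[OF terms_summable]
          summable_on_subset_banach[OF weight_summable]) auto
    ultimately have "r x y \<le> 2 * e / 3"
      unfolding r_infsum split[OF terms_summable] using tail by linarith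
    then show ?thesis using assms by linarith
  qed
  then show ?thesis using F(1) d by blast
qed

sublocale Metric_space UNIV r
  unfolding r_eq by (rule Metric_space_seq_metric[OF a_nonneg a_summable])

text \<open>By \<open>r_small\<close> the identity from the product topology to the topology of
  \<open>r\<close> is continuous, and Tychonoff's theorem makes its domain compact.\<close>

sublocale compact_metric r
proof
  let ?P = "product_topology (\<lambda>_::int. euclidean :: 'a topology) UNIV"
  have "continuous_map ?P mtopology (\<lambda>x. x)"
    unfolding continuous_map_def
  proof (intro conjI allI impI)
    fix U assume U: "openin mtopology U"
    show "openin ?P {x \<in> topspace ?P. x \<in> U}"
    proof (subst openin_subopen, intro ballI)
      fix x assume "x \<in> {x \<in> topspace ?P. x \<in> U}"
      then obtain e where e: "0 < e" "mball x e \<subseteq> U" using U unfolding openin_mtopology by auto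
      obtain F d where F: "finite F" "0 < d" "\<And>y. \<forall>n\<in>F. dist (x n) (y n) < d \<Longrightarrow> r x y < e"
        using r_small[OF e(1)] by blast
      let ?V = "\<Pi>\<^sub>E n\<in>UNIV. if n \<in> F then ball (x n) d else UNIV"
      have "openin ?P ?V"
      proof (rule product_topology_basis)
        show "finite {n. (if n \<in> F then ball (x n) d else UNIV) \<noteq> topspace euclidean}"
          by (rule finite_subset[OF _ F(1)]) auto
      qed auto
      moreover have "x \<in> ?V" using F(2) by (auto simp: PiE_iff)
      moreover have "?V \<subseteq> {x \<in> topspace ?P. x \<in> U}"
      proof
        fix y assume y: "y \<in> ?V"
        have "dist (x n) (y n) < d" if "n \<in> F" for n
          using y that unfolding PiE_iff by (metis UNIV_I mem_ball)
        then have "y \<in> U" using F(3) e(2) by auto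
        then show "y \<in> {x \<in> topspace ?P. x \<in> U}" by (simp add: topspace_product_topology)
      qed
      ultimately show "\<exists>V. openin ?P V \<and> x \<in> V \<and> V \<subseteq> {x \<in> topspace ?P. x \<in> U}" by blast
    qed
  qed auto
  moreover have "compactin ?P (topspace ?P)"
    using base_compact compact_space_product_topology[of "\<lambda>_::int. euclidean :: 'a topology" UNIV]
    unfolding compact_space_def by simp
  ultimately have "compactin mtopology ((\<lambda>x. x) ` topspace ?P)" by (rule image_compactin[rotated])
  then show "compact_space mtopology"
    by (simp add: compact_space_def topspace_product_topology)
qed

abbreviation "X \<equiv> borel_of mtopology"

lemma coordinate_measurable:
  assumes "sets M = sets X"
  shows "(\<lambda>x. x n) \<in> borel_measurable M"
proof (rule borel_measurableI)
  fix S :: "'a set" assume S: "open S"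
  have "openin mtopology {x. x n \<in> S}"
  proof (rule openinI)
    fix x assume "x \<in> {x. x n \<in> S}"
    then obtain e where e: "0 < e" "ball (x n) e \<subseteq> S"
      using S open_contains_ball by (metis mem_Collect_eq)
    show "\<exists>d>0. \<forall>y. r x y < d \<longrightarrow> y \<in> {x. x n \<in> S}"
    proof (intro exI[of _ "min (weight n) e"] conjI allI impI)
      fix y assume "r x y < min (weight n) e"
      then have "dist (x n) (y n) < e" using term_le_r[of n x y] by auto
      then show "y \<in> {x. x n \<in> S}" using e by auto
    qed (use weight_pos e in auto)
  qed
  then show "(\<lambda>x. x n) -` S \<inter> space M \<in> sets M"
    using assms sets_eq_imp_space_eq[OF assms] openin_borel_of
    by (auto simp: space_borel_of vimage_def)
qed

text \<open>Enumerating the integers turns the distance to a fixed point into a series of measurable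
  functions, and \<open>measurable_by_dist\<close> reduces measurability to such distances.\<close>

lemma measurable_coordinatewise:
  assumes "\<And>n. (\<lambda>\<omega>. Y \<omega> n) \<in> borel_measurable M"
  shows "Y \<in> measurable M X"
proof (rule measurable_by_dist)
  fix w
  let ?t = "\<lambda>\<omega> k. min (weight (int_decode k)) (dist (w (int_decode k)) (Y \<omega> (int_decode k)))"
  have "r w (Y \<omega>) = (\<Sum>k. ?t \<omega> k)" for \<omega>
  proof -
    have "?t \<omega> summable_on UNIV"
      using summable_on_reindex_bij_betw[OF bij_int_decode,
          of "\<lambda>n. min (weight n) (dist (w n) (Y \<omega> n))"] terms_summable by simp
    then have "?t \<omega> sums (\<Sum>\<^sub>\<infinity>k. ?t \<omega> k)" by (intro has_sum_imp_sums has_sum_infsum)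
    moreover have "(\<Sum>\<^sub>\<infinity>k. ?t \<omega> k) = r w (Y \<omega>)"
      unfolding r_infsum
      by (rule infsum_reindex_bij_betw[OF bij_int_decode,
          of "\<lambda>n. min (weight n) (dist (w n) (Y \<omega> n))"])
    ultimately show ?thesis by (simp add: sums_iff)
  qed
  moreover have "(\<lambda>\<omega>. dist c (Y \<omega> n)) \<in> borel_measurable M" for c n
    by (rule measurable_compose[OF assms borel_measurable_continuous_onI]) (intro continuous_intros)
  ultimately show "(\<lambda>\<omega>. r w (Y \<omega>)) \<in> borel_measurable M"
    by (simp only:) (intro borel_measurable_suminf borel_measurable_min borel_measurable_const)
qed

lemma full_shift_measurable:
  assumes "sets M = sets X"
  shows "full_shift \<in> measurable M X"
  unfolding full_shift_def
  by (rule measurable_coordinatewise) (rule coordinate_measurable[OF assms])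

section \<open>The perturbed measure: invariance, closeness and infinite dimension\<close>

definition perturb :: "('a \<Rightarrow> 'a) \<Rightarrow> ('a \<Rightarrow> 'a) \<Rightarrow> (int \<Rightarrow> 'a) \<times> (int \<Rightarrow> bool) \<Rightarrow> int \<Rightarrow> 'a" where
  "perturb p p' \<omega> n = (if snd \<omega> n then p (fst \<omega> n) else p' (fst \<omega> n))"

definition perturbed :: "('a \<Rightarrow> 'a) \<Rightarrow> ('a \<Rightarrow> 'a) \<Rightarrow> (int \<Rightarrow> 'a) measure \<Rightarrow> (int \<Rightarrow> 'a) measure" where
  "perturbed p p' \<mu> = distr (\<mu> \<Otimes>\<^sub>M coin_flips) X (perturb p p')"

lemma perturb_measurable:
  assumes [measurable]: "p \<in> borel_measurable borel" "p' \<in> borel_measurable borel"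
    and \<mu>: "\<mu> \<in> borel_probs mtopology"
  shows "perturb p p' \<in> measurable (\<mu> \<Otimes>\<^sub>M coin_flips) X"
proof (rule measurable_coordinatewise)
  fix n
  note [measurable] = coordinate_measurable[OF borel_probsD(2)[OF \<mu>]] coin_measurable
  show "(\<lambda>\<omega>. perturb p p' \<omega> n) \<in> borel_measurable (\<mu> \<Otimes>\<^sub>M coin_flips)"
    unfolding perturb_def by measurable
qed

lemma prob_space_pair_coin_flips:
  assumes "\<mu> \<in> borel_probs mtopology"
  shows "prob_space (\<mu> \<Otimes>\<^sub>M coin_flips)"
  using borel_probsD(1)[OF assms] prob_space_coin_flips by (rule prob_space_pair)

lemma perturbed_borel_probs:
  assumes "p \<in> borel_measurable borel" "p' \<in> borel_measurable borel" "\<mu> \<in> borel_probs mtopology"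
  shows "perturbed p p' \<mu> \<in> borel_probs mtopology"
proof -
  have "prob_space (perturbed p p' \<mu>)"
    unfolding perturbed_def using prob_space_pair_coin_flips[OF assms(3)] perturb_measurable[OF assms]
    by (rule prob_space.prob_space_distr)
  then show ?thesis by (simp add: borel_probs_def perturbed_def)
qed

lemma distr_full_shift:
  assumes "\<mu> \<in> invariant_probs mtopology full_shift"
  shows "distr \<mu> \<mu> full_shift = \<mu>"
proof (rule measure_eqI)
  have sets: "sets \<mu> = sets X" using assms by (simp add: invariant_probs_def borel_probsD(2))
  have "full_shift \<in> measurable \<mu> \<mu>"
    using full_shift_measurable[OF sets] by (simp cong: measurable_cong_sets add: sets)
  then show "emeasure (distr \<mu> \<mu> full_shift) A = emeasure \<mu> A" if "A \<in> sets (distr \<mu> \<mu> full_shift)" for A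
    using assms that by (simp add: emeasure_distr invariant_probs_def)
qed simp

text \<open>The product of \<open>\<mu>\<close> with the coin measure is invariant under shifting
  both components, and \<open>perturb\<close> commutes with the shifts because the same
  \<open>p\<close> and \<open>p'\<close> act at every coordinate. So the pushforward is
  invariant.\<close>

lemma perturbed_invariant:
  assumes p: "p \<in> borel_measurable borel" "p' \<in> borel_measurable borel"
    and \<mu>: "\<mu> \<in> invariant_probs mtopology full_shift"
  shows "perturbed p p' \<mu> \<in> invariant_probs mtopology full_shift"
proof -
  have \<mu>': "\<mu> \<in> borel_probs mtopology" using \<mu> by (simp add: invariant_probs_def)
  note sets = borel_probsD(2)[OF \<mu>']
  interpret prob_space \<mu> using borel_probsD[OF \<mu>'] by simp
  have shift: "full_shift \<in> measurable \<mu> \<mu>"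
    using full_shift_measurable[OF sets] by (simp cong: measurable_cong_sets add: sets)
  let ?P = "\<mu> \<Otimes>\<^sub>M coin_flips"
  let ?S = "\<lambda>(x, b). (full_shift x, full_shift b)"
  note Y = perturb_measurable[OF p \<mu>']
  have S: "?S \<in> measurable ?P ?P"
    using shift full_shift_coin_flips(1) by (simp add: measurable_split_conv) measurable
  have "distr ?P ?P ?S = ?P"
    using pair_measure_distr[OF shift full_shift_coin_flips(1)]
    by (simp add: full_shift_coin_flips(2) distr_full_shift[OF \<mu>] prob_space_coin_flips
        prob_space_imp_sigma_finite)
  then have "perturbed p p' \<mu> = distr (distr ?P ?P ?S) X (perturb p p')"
    by (simp add: perturbed_def)
  also have "\<dots> = distr ?P X (perturb p p' \<circ> ?S)" by (rule distr_distr[OF Y S])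
  also have "perturb p p' \<circ> ?S = full_shift \<circ> perturb p p'"
    by (auto simp: fun_eq_iff perturb_def full_shift_def)
  also have "distr ?P X (full_shift \<circ> perturb p p') = distr (perturbed p p' \<mu>) X full_shift"
    unfolding perturbed_def by (rule distr_distr[OF full_shift_measurable Y, symmetric]) simp
  finally have eq: "perturbed p p' \<mu> = distr (perturbed p p' \<mu>) X full_shift" .
  have sets': "sets (perturbed p p' \<mu>) = sets X" by (simp add: perturbed_def)
  have "emeasure (perturbed p p' \<mu>) (full_shift -` A \<inter> space (perturbed p p' \<mu>)) = emeasure (perturbed p p' \<mu>) A"
    if "A \<in> sets (perturbed p p' \<mu>)" for A
    using arg_cong[OF eq, of "\<lambda>M. emeasure M A"] that
    by (simp add: emeasure_distr[OF full_shift_measurable[OF sets']] sets')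
  then show ?thesis
    using perturbed_borel_probs[OF p \<mu>'] by (simp add: invariant_probs_def)
qed

text \<open>The product space couples \<open>\<mu>\<close> with its perturbation: both integrals
  become integrals over it, and their integrands differ pointwise by less than
  \<open>\<eta>\<close>.\<close>

lemma perturbed_near:
  assumes p: "p \<in> borel_measurable borel" "p' \<in> borel_measurable borel"
    and \<mu>: "\<mu> \<in> borel_probs mtopology"
    and near: "\<And>\<omega>. r (fst \<omega>) (perturb p p' \<omega>) < d"
    and f: "continuous_map mtopology euclideanreal f" "\<And>x y. r x y < d \<Longrightarrow> \<bar>f x - f y\<bar> < \<eta>"
  shows "\<bar>(\<integral>x. f x \<partial>\<mu>) - (\<integral>x. f x \<partial>perturbed p p' \<mu>)\<bar> \<le> \<eta>"
proof -
  let ?P = "\<mu> \<Otimes>\<^sub>M coin_flips"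
  interpret C: prob_space coin_flips by (rule prob_space_coin_flips)
  interpret P: prob_space ?P by (rule prob_space_pair_coin_flips[OF \<mu>])
  note Y = perturb_measurable[OF p \<mu>]
  have fX: "f \<in> borel_measurable X" "f \<in> borel_measurable \<mu>"
    using continuous_map_borel_measurable[OF _ f(1)] borel_probsD(2)[OF \<mu>] by auto
  have "compactin euclideanreal (f ` topspace mtopology)"
    using image_compactin[OF _ f(1)] compact unfolding compact_space_def by blast
  then have bdd: "bounded (range f)" by (simp add: compact_imp_bounded)
  have m1: "(\<lambda>\<omega>. f (fst \<omega>)) \<in> borel_measurable ?P"
    by (rule measurable_compose[OF measurable_fst fX(2)])
  have m2: "(\<lambda>\<omega>. f (perturb p p' \<omega>)) \<in> borel_measurable ?P"
    by (rule measurable_compose[OF Y fX(1)])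
  have int: "integrable ?P (\<lambda>\<omega>. f (fst \<omega>))" "integrable ?P (\<lambda>\<omega>. f (perturb p p' \<omega>))"
    by (intro prob_space.integrable_bounded_range P.prob_space_axioms m1 m2 bounded_subset[OF bdd],
        blast)+
  have "(\<integral>x. f x \<partial>\<mu>) = (\<integral>x. f x \<partial>distr ?P \<mu> fst)" by (simp add: C.distr_pair_fst)
  also have "\<dots> = (\<integral>\<omega>. f (fst \<omega>) \<partial>?P)" by (rule integral_distr[OF measurable_fst fX(2)])
  finally have 1: "(\<integral>x. f x \<partial>\<mu>) = (\<integral>\<omega>. f (fst \<omega>) \<partial>?P)" .
  have 2: "(\<integral>x. f x \<partial>perturbed p p' \<mu>) = (\<integral>\<omega>. f (perturb p p' \<omega>) \<partial>?P)"
    unfolding perturbed_def by (rule integral_distr[OF Y fX(1)])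
  have "\<bar>(\<integral>\<omega>. f (fst \<omega>) \<partial>?P) - (\<integral>\<omega>. f (perturb p p' \<omega>) \<partial>?P)\<bar>
      = \<bar>\<integral>\<omega>. f (fst \<omega>) - f (perturb p p' \<omega>) \<partial>?P\<bar>"
    by (simp only: Bochner_Integration.integral_diff[OF int])
  also have "\<dots> \<le> (\<integral>\<omega>. \<bar>f (fst \<omega>) - f (perturb p p' \<omega>)\<bar> \<partial>?P)" by (rule integral_abs_bound)
  also have "\<dots> \<le> (\<integral>\<omega>. \<eta> \<partial>?P)"
    using f(2)[OF near] by (intro integral_mono integrable_abs Bochner_Integration.integrable_diff int)
      (auto intro: less_imp_le)
  finally show ?thesis unfolding 1 2 by (simp add: P.prob_space)
qed

text \<open>Condition on the unperturbed point \<open>x\<close>. At each \<open>n\<close> in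
  \<open>J\<close> the ball keeps the coordinate within \<open>e\<close> of \<open>y n\<close>,
  which cannot hold for both \<open>p (x n)\<close> and \<open>p' (x n)\<close>. So at most one
  outcome of each coin is allowed, and the resulting bound is uniform in \<open>x\<close>.\<close>

lemma perturbed_ball_le:
  assumes p: "p \<in> borel_measurable borel" "p' \<in> borel_measurable borel"
    and \<mu>: "\<mu> \<in> borel_probs mtopology"
    and J: "finite J" "\<And>n. n \<in> J \<Longrightarrow> e \<le> weight n"
    and e: "\<And>z. 2 * e \<le> dist (p z) (p' z)"
  shows "measure (perturbed p p' \<mu>) (mball y e) \<le> (1 / 2) ^ card J"
proof -
  let ?P = "\<mu> \<Otimes>\<^sub>M coin_flips"
  interpret C: prob_space coin_flips by (rule prob_space_coin_flips)
  interpret prob_space \<mu> using borel_probsD[OF \<mu>] by simp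
  interpret N: prob_space "perturbed p p' \<mu>" using borel_probsD[OF perturbed_borel_probs[OF p \<mu>]] by simp
  note Y = perturb_measurable[OF p \<mu>]
  let ?A = "perturb p p' -` mball y e \<inter> space ?P"
  have A: "?A \<in> sets ?P" using Y mball_sets by (rule measurable_sets)
  have fibre: "emeasure coin_flips (Pair x -` ?A) \<le> ennreal ((1 / 2) ^ card J)" for x
  proof -
    let ?E = "\<lambda>n. {c. dist (y n) (if c then p (x n) else p' (x n)) < e}"
    have "Pair x -` ?A \<subseteq> {b. \<forall>n\<in>J. b n \<in> ?E n}"
    proof (intro subsetI CollectI ballI)
      fix b n assume b: "b \<in> Pair x -` ?A" and n: "n \<in> J"
      then have "r y (perturb p p' (x, b)) < e" by auto
      then have "min (weight n) (dist (y n) (perturb p p' (x, b) n)) < e"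
        using term_le_r[of n y "perturb p p' (x, b)"] by linarith
      \<comment> \<open>As \<open>weight n\<close> is at least \<open>e\<close>, the minimum can
        only be small through the distance.\<close>
      then have "dist (y n) (perturb p p' (x, b) n) < e" using J(2)[OF n] by auto
      then show "dist (y n) (if b n then p (x n) else p' (x n)) < e"
        by (simp only: perturb_def fst_conv snd_conv)
    qed
    moreover have "{b. \<forall>n\<in>J. b n \<in> ?E n} \<in> sets coin_flips"
    proof -
      have "{b. b n \<in> ?E n} \<in> sets coin_flips" for n
        using measurable_sets[OF coin_measurable[of n], of "?E n"] by (simp add: vimage_def)
      then have "{b\<in>space coin_flips. \<forall>n\<in>J. b n \<in> ?E n} \<in> sets coin_flips"
        by (intro sets.sets_Collect_finite_All J) simp
      then show ?thesis by simp
    qed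
    ultimately have "emeasure coin_flips (Pair x -` ?A) \<le> emeasure coin_flips {b. \<forall>n\<in>J. b n \<in> ?E n}"
      by (rule emeasure_mono)
    also have "\<dots> \<le> ennreal ((1 / 2) ^ card J)"
    proof (rule emeasure_coin_flips_le[OF J(1)])
      fix n show "?E n \<noteq> UNIV"
      proof
        assume "?E n = UNIV"
        then have "True \<in> ?E n" "False \<in> ?E n" by blast+
        then have "dist (p (x n)) (p' (x n)) < 2 * e"
          using dist_triangle3[of "p (x n)" "p' (x n)" "y n"] by simp
        then show False using e[of "x n"] by simp
      qed
    qed
    finally show ?thesis .
  qed
  have "emeasure (perturbed p p' \<mu>) (mball y e) = emeasure ?P ?A"
    unfolding perturbed_def using mball_sets by (rule emeasure_distr[OF Y])
  also have "\<dots> = (\<integral>\<^sup>+x. emeasure coin_flips (Pair x -` ?A) \<partial>\<mu>)"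
    by (rule C.emeasure_pair_measure_alt[OF A])
  also have "\<dots> \<le> (\<integral>\<^sup>+x. ennreal ((1 / 2) ^ card J) \<partial>\<mu>)" using fibre by (intro nn_integral_mono) auto
  also have "\<dots> = ennreal ((1 / 2) ^ card J)"
    by (simp only: nn_integral_const emeasure_space_1 mult_1_right)
  finally show ?thesis unfolding N.emeasure_eq_measure by (subst (asm) ennreal_le_iff) simp_all
qed

text \<open>At the scale \<open>exp (- \<alpha> * k) / 3\<close> at least \<open>k\<close>
  coordinates have large enough weight, so balls have mass at most \<open>(1 / 2) ^ k\<close> and
  the soft correlation is at most \<open>exp (- \<beta> * k)\<close>. Subexponential growth allows
  \<open>\<alpha>\<close> to be arbitrarily small, so this beats any power of the scale.\<close>

lemma perturbed_infinite_dim: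
  assumes p: "p \<in> borel_measurable borel" "p' \<in> borel_measurable borel"
    and \<mu>: "\<mu> \<in> borel_probs mtopology"
    and \<rho>: "0 < \<rho>" "\<And>z. 2 * \<rho> \<le> dist (p z) (p' z)"
    and mono: "mono a"
    and subexp: "\<And>\<alpha>::real. \<alpha> > 0 \<Longrightarrow> (\<lambda>k. a k / exp (\<alpha> * real k)) \<longlonglongrightarrow> 0"
    and q: "1 < q"
  shows "upper_gen_dim r (perturbed p p' \<mu>) q = \<infinity>"
proof -
  let ?\<nu> = "perturbed p p' \<mu>"
  have \<nu>: "?\<nu> \<in> borel_probs mtopology" by (rule perturbed_borel_probs[OF p \<mu>])
  have "\<exists>e. 0 < e \<and> e < 1 / real (Suc n) \<and> soft_correlation ?\<nu> q e < e ^ n" for n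
  proof -
    define \<beta> where "\<beta> = (q - 1) * ln 2"
    have \<beta>: "0 < \<beta>" using q by (simp add: \<beta>_def)
    \<comment> \<open>The \<open>n\<close>-th power of the scale then costs at most half of the
      decay rate \<open>\<beta>\<close>; the other half absorbs the constant
      \<open>(1 / 3) ^ n\<close>. The successor covers \<open>n = 0\<close>.\<close>
    define \<alpha> where "\<alpha> = \<beta> / (2 * real (Suc n))"
    have \<alpha>: "0 < \<alpha>" using \<beta> by (simp add: \<alpha>_def)
    have half: "real n * \<alpha> \<le> \<beta> / 2" using \<beta> by (simp add: \<alpha>_def field_simps)
    \<comment> \<open>The divisor 3 matches the bound
      \<open>a k + 1 < 3 * exp (\<alpha> * real k)\<close>, so that the weights at indices below
      \<open>k\<close> are at least \<open>?e k\<close>.\<close>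
    let ?e = "\<lambda>k. exp (- \<alpha> * real k) / 3"
    have lim: "(\<lambda>k. exp (- c * real k)) \<longlonglongrightarrow> 0" if "0 < c" for c :: real
      using that by real_asymp
    have "\<forall>\<^sub>F k in sequentially. a k / exp (\<alpha> * real k) < 1"
      using order_tendstoD(2)[OF subexp[OF \<alpha>], of 1] by simp
    moreover have "\<forall>\<^sub>F k in sequentially. exp (- \<alpha> * real k) < min \<rho> (1 / real (Suc n))"
      using \<rho>(1) by (intro order_tendstoD(2)[OF lim[OF \<alpha>]]) simp
    moreover have "\<forall>\<^sub>F k in sequentially. exp (- (\<beta> / 2) * real k) < (1 / 3) ^ n"
      using \<beta> by (intro order_tendstoD(2)[OF lim]) auto
    ultimately have "\<forall>\<^sub>F k in sequentially. a k / exp (\<alpha> * real k) < 1 \<and>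
        exp (- \<alpha> * real k) < min \<rho> (1 / real (Suc n)) \<and> exp (- (\<beta> / 2) * real k) < (1 / 3) ^ n"
      by eventually_elim simp
    then obtain k where k: "a k / exp (\<alpha> * real k) < 1"
      "exp (- \<alpha> * real k) < min \<rho> (1 / real (Suc n))" "exp (- (\<beta> / 2) * real k) < (1 / 3) ^ n"
      using eventually_happens'[OF sequentially_bot] by blast
    let ?J = "int ` {..<k}"
    have pos: "0 < ?e k" by simp
    have lt: "?e k < exp (- \<alpha> * real k)" by simp
    have "a k < exp (\<alpha> * real k)" using k(1) by simp
    moreover have "1 \<le> exp (\<alpha> * real k)" using \<alpha> by simp
    ultimately have ak: "a k + 1 < 3 * exp (\<alpha> * real k)" by linarith
    have weight: "?e k \<le> weight m" if m: "m \<in> ?J" for m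
    proof -
      obtain j where j: "m = int j" "j < k" using m by auto
      have "a j \<le> a k" using mono j(2) by (simp add: monoD)
      then have "a j + 1 \<le> 3 * exp (\<alpha> * real k)" using ak by linarith
      then have "1 / (3 * exp (\<alpha> * real k)) \<le> 1 / (a j + 1)"
        using a_nonneg[of j] by (intro divide_left_mono) auto
      also have "1 / (3 * exp (\<alpha> * real k)) = ?e k" by (simp add: exp_minus field_simps)
      finally show ?thesis by (simp add: weight_def j(1))
    qed
    have "measure ?\<nu> (mball y (?e k)) \<le> (1 / 2) ^ card ?J" for y
    proof (rule perturbed_ball_le[OF p \<mu> _ weight])
      show "2 * ?e k \<le> dist (p z) (p' z)" for z
        using \<rho>(2)[of z] lt k(2) unfolding min_less_iff_conj by linarith
    qed simp
    then have "soft_correlation ?\<nu> q (?e k) \<le> ((1 / 2) ^ card ?J) powr (q - 1)"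
      by (rule soft_correlation_le[OF \<nu> pos q])
    also have "\<dots> = exp (- \<beta> * real k)"
    proof -
      have "ln ((1 / 2 :: real) ^ k) = - (real k * ln 2)"
        using ln_divide_pos[of 1 "2::real"] by (simp add: ln_realpow)
      then show ?thesis by (simp add: card_image powr_def \<beta>_def mult.commute mult.left_commute)
    qed
    also have "\<dots> = exp (- (\<beta> / 2) * real k) * exp (- (\<beta> / 2) * real k)"
      by (simp only: exp_add[symmetric]) (simp add: field_simps)
    also have "\<dots> < (1 / 3) ^ n * exp (- (\<beta> / 2) * real k)"
      using k(3) by (intro mult_strict_right_mono) auto
    also have "\<dots> \<le> (1 / 3) ^ n * exp (- (real n * \<alpha>) * real k)"
      using mult_right_mono[OF half, of "real k"] by (intro mult_left_mono) auto
    also have "\<dots> = ?e k ^ n"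
    proof -
      have "exp (- \<alpha> * real k) ^ n = exp (- (real n * \<alpha>) * real k)"
        unfolding exp_of_nat_mult[symmetric] by (simp add: mult.assoc)
      then show ?thesis by (simp only: power_divide power_one times_divide_eq_left mult_1_left)
    qed
    finally have "soft_correlation ?\<nu> q (?e k) < ?e k ^ n" .
    moreover have "?e k < 1 / real (Suc n)"
      using lt k(2) unfolding min_less_iff_conj by linarith
    ultimately show ?thesis using pos by blast
  qed
  then show ?thesis using upper_gen_dim_infinite_iff[OF \<nu> q] by simp
qed

lemma dense_infinite_dim:
  assumes mono: "mono a"
    and subexp: "\<And>\<alpha>::real. \<alpha> > 0 \<Longrightarrow> (\<lambda>k. a k / exp (\<alpha> * real k)) \<longlonglongrightarrow> 0"
    and q: "1 < q"
  shows "weak_topology mtopology (invariant_probs mtopology full_shift) closure_of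
      {\<mu> \<in> invariant_probs mtopology full_shift. upper_gen_dim r \<mu> q = \<infinity>}
    = invariant_probs mtopology full_shift" (is "?W closure_of ?C = ?MT")
proof (intro equalityI subsetI)
  fix \<mu> assume "\<mu> \<in> ?W closure_of ?C"
  then show "\<mu> \<in> ?MT" using closure_of_subset_topspace[of ?W ?C] by (auto simp: topspace_weak_topology)
next
  fix \<mu> assume \<mu>: "\<mu> \<in> ?MT"
  then have \<mu>': "\<mu> \<in> borel_probs mtopology" by (simp add: invariant_probs_def)
  show "\<mu> \<in> ?W closure_of ?C"
  proof (rule in_closure_of_weak_topology[OF \<mu>])
    fix d :: real assume "0 < d"
    \<comment> \<open>Both maps will move each letter by less than \<open>c\<close>, so every
      perturbed point stays within \<open>d\<close> of the original, whatever the coins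
      show.\<close>
    then obtain F c where F: "0 < c" "\<And>x y. \<forall>n\<in>F. dist (x n) (y n) < c \<Longrightarrow> r x y < d"
      using r_small by blast
    obtain p p' :: "'a \<Rightarrow> 'a" and \<rho> :: real where p:
      "p \<in> borel_measurable borel" "p' \<in> borel_measurable borel" "0 < \<rho>"
      "\<And>z. dist z (p z) < c" "\<And>z. dist z (p' z) < c" "\<And>z. 2 * \<rho> \<le> dist (p z) (p' z)"
      by (rule two_point_perturbation[OF base_compact F(1)]) (rule that)
    have near: "r (fst \<omega>) (perturb p p' \<omega>) < d" for \<omega>
      using p(4,5) by (intro F(2)) (simp add: perturb_def)
    have "perturbed p p' \<mu> \<in> ?C"
      using perturbed_invariant[OF p(1,2) \<mu>] perturbed_infinite_dim[OF p(1,2) \<mu>' p(3,6) mono subexp q]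
      by simp
    then show "\<exists>\<nu>\<in>?C. \<forall>f \<eta>. continuous_map mtopology euclideanreal f \<longrightarrow>
        (\<forall>x y. r x y < d \<longrightarrow> \<bar>f x - f y\<bar> < \<eta>) \<longrightarrow> \<bar>(\<integral>x. f x \<partial>\<mu>) - (\<integral>x. f x \<partial>\<nu>)\<bar> \<le> \<eta>"
      using perturbed_near[OF p(1,2) \<mu>' near] by blast
  qed auto
qed

end

theorem theorem1p3:
  fixes a :: "nat \<Rightarrow> real" and q :: real
    and r :: "(int \<Rightarrow> 'a :: {metric_space, perfect_space}) \<Rightarrow> (int \<Rightarrow> 'a) \<Rightarrow> real"
    and MT CD :: "(int \<Rightarrow> 'a) measure set"
  assumes compact: "compact (UNIV :: 'a set)"
    and a_mono: "mono a"
    and a_nonneg: "\<And>k. 0 \<le> a k"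
    and a_summable: "summable (\<lambda>k. 1 / (a k + 1))"
    and a_subexp: "\<And>\<alpha>::real. \<alpha> > 0 \<Longrightarrow> (\<lambda>k. a k / exp (\<alpha> * real k)) \<longlonglongrightarrow> 0"
    and q: "q > 1"
  defines "r \<equiv> seq_metric a"
    and "MT \<equiv> invariant_probs (metric_topology r) full_shift"
    and "CD \<equiv> {\<mu> \<in> MT. upper_gen_dim r \<mu> q = \<infinity>}"
  shows "gdelta_in (weak_topology (metric_topology r) MT) CD
       \<and> weak_topology (metric_topology r) MT closure_of CD = MT"
proof -
  interpret shift_space a r
    using compact a_nonneg a_summable r_def by (intro shift_space.intro) simp_all
  have "MT \<subseteq> borel_probs (metric_topology r)" by (auto simp: MT_def invariant_probs_def)
  then show ?thesis
    using gdelta_in_infinite_dim[OF _ q] dense_infinite_dim[OF a_mono a_subexp q]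
    unfolding CD_def MT_def by blast
qed

end
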